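(* Deterministic non-convex case. Assume (A1)--(A3) of the context, $\mu<0$, and that exact gradients and Hessian/Jacobian-vector products are used (all variances are zero), with batches of size $1$. Run AmIGO with $\alpha_k=L_g^{-1}$, $\beta_k=(2L_g)^{-1}$, $\gamma_k=L^{-1}$ and $T,N$ as in the context (both $O(\kappa_g)$ up to logarithmic factors). Then for every $\epsilon>0$ AmIGO achieves $\frac1k\sum_{i=1}^k\|\nabla\mathcal L(x_i)\|^2\le\epsilon$ with complexity $$\mathcal C(\epsilon)=O\Big(\frac{\kappa_g^4}{\epsilon}\big((\mathcal L(x_0)-\mathcal L^\star)+E_0^y+E_0^z\big)\Big),$$ where $O$ treats $L_f,B,L_g,L_g',M_g$ as fixed constants and suppresses factors logarithmic in $\kappa_g$.
   Context: **Problem.** $\mathcal X=\mathbb R^{d_x}$, $\mathcal Y=\mathbb R^{d_y}$; $f,g:\mathcal X\times\mathcal Y\to\mathbb R$, $f$ differentiable, $g$ twice differentiable; $\partial_{xy}g(x,y)$ is the $d_x\times d_y$ matrix with entries $\partial^2g/\partial x_i\partial y_j$. $y^\star(x)=\arg\min_yg(x,y)$, $z^\star(x,y)=-\partial_{yy}g(x,y)^{-1}\partial_yf(x,y)$, $\mathcal L(x)=f(x,y^\star(x))$, $\mathcal L^\star=\inf\mathcal L$ (assumed finite). **Assumptions.** (A1) For every $x$, $y\mapsto g(x,y)$ is $L_g$-smooth and $\mu_g$-strongly convex ($\mu_g>0$); $\kappa_g=L_g/\mu_g$. (A2) $\nabla f$ is $L_f$-Lipschitz and $\|\partial_yf\|\le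 B$. (A3) $\partial_{xy}g,\partial_{yy}g$ are $M_g$-Lipschitz in $(x,y)$; $\|\partial_yg(x,y)-\partial_yg(x',y)\|\le L_g'\|x-x'\|$. **Constants.** $L_y=\mu_g^{-1}L_g'$, $L_z=\mu_g^{-2}M_gB+\mu_g^{-1}L_f$, $L_\psi=\max(L_f+M_g\mu_g^{-1}B+L_g'L_z,L_g')$, $L=(L_f+\mu_g^{-2}L_g'M_gB+\mu_g^{-1}(L_g'L_f+M_gB))(1+\mu_g^{-1}L_g')$. $\mathcal L$ is $L$-smooth, hence satisfies $\mathcal L(x)-\mathcal L(x')\le\nabla\mathcal L(x)^\top(x-x')-\frac\mu2\|x-x'\|^2$ for a $\mu$ with $|\mu|\le L$; the non-convex case refers to $\mu<0$ (no convexity of $\mathcal L$ is assumed). **AmIGO (deterministic).** Given $x_0,y_{-1},z_{-1}$, for $k\ge0$: $y_k$ is obtained from $y_k^0=y_{k-1}$ by $T$ steps $y\leftarrow y-\alpha_k\partial_yg(x_k,y)$; $v_k=\partial_yf(x_k,y_k)$; $z_k$ is obtained from $z_k^0=z_{k-1}$ by $N$ steps $z\leftarrow z-\beta_k(\partial_{yy}g(x_k,y_k)z+v_k)$; $\hat\psi_k=\partial_xf(x_k,y_k)+\partial_{xy}g(x_k,y_k)z_k$; $x_{k+1}=x_k-\gamma_{k+1}\hat\psi_k$. $E_0^y=\|y_{-1}-y^\star(x_0)\|^2$, $E_0^z=\|z_{-1}-z^\star(x_0,y_0)\|^2$. **Complexity.** $\mathcal C(\epsilon)=k(T|\mathcal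 D_g|+N|\mathcal D_{g_{yy}}|+|\mathcal D_{g_{xy}}|+|\mathcal D_f|)$ with all batch sizes 1: the total number of gradient evaluations of $f,g$ and Jacobian/Hessian-vector products over the $k$ outer iterations used. **Choice of $T,N$.** With $\eta_0=L$, $\gamma=L^{-1}$, $\alpha=L_g^{-1}$, $\beta=(2L_g)^{-1}$, $\zeta_0=2L$: $T=\lfloor\alpha^{-1}\mu_g^{-1}\max(C_1,C_2,C_3)\rfloor+1$, $N=\lfloor2\beta^{-1}\mu_g^{-1}(\max(C_1,C_2,C_3)+\max(C_1',C_2',C_3'))\rfloor+1$, where $C_1=1+2\log(6+24L_\psi^2\eta_0^{-1})$, $C_2=2\log(1+4L_y^2L^{-2}\max(\eta_0,8\zeta_0))$, $C_3=\max(0,-2\log(5L_\psi^2\eta_0^{-1}),-2\log\frac L{4L_y^2})$, $C_1'=1+2\log(4+24\eta_0^{-1}L_\psi^2)$, $C_2'=2\log(1+2L_z^2L_y^{-2}(1+16L_y^2))$, $C_3'=\max(0,-2\log\frac{L_\psi^2}{4L_z^2\eta_0},-2\log(\gamma(L_g')^2))$.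
   Formalization: The complexity is bounded by the maximum of the cost of one outer iteration and the stated O-bound, since at least one iteration is needed and the O-bound can be smaller than its cost (large ε, or a zero bracket); L_g' > 0 and L_f + M_g B > 0 are assumed so that the constants are defined. *)

theory Defs
  imports "HOL-Analysis.Analysis"
begin

section \<open>Gradients, second-order partial derivatives, regularity classes\<close>

definition grad :: "('a::real_inner \<Rightarrow> real) \<Rightarrow> 'a \<Rightarrow> 'a" where
  "grad h x = (THE D. GDERIV h x :> D)"

definition grad_x :: "((real^'dx) \<times> (real^'dy) \<Rightarrow> real) \<Rightarrow> (real^'dx) \<times> (real^'dy) \<Rightarrow> real^'dx" where
  "grad_x h = (\<lambda>(x, y). grad (\<lambda>u. h (u, y)) x)"

definition grad_y :: "((real^'dx) \<times> (real^'dy) \<Rightarrow> real) \<Rightarrow> (real^'dx) \<times> (real^'dy) \<Rightarrow> real^'dy" where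
  "grad_y h = (\<lambda>(x, y). grad (\<lambda>v. h (x, v)) y)"

text \<open>
  The Jacobian of \<open>u \<mapsto> grad_y h (u, y)\<close> has rows indexed by the coordinates of \<open>y\<close>. Its
  transpose is the matrix of size \<open>dx\<close> times \<open>dy\<close> whose entry \<open>(i, j)\<close> is the derivative with
  respect to \<open>x\<^sub>i\<close> of the partial derivative of \<open>h\<close> with respect to \<open>y\<^sub>j\<close>.
\<close>

definition hess_xy :: "((real^'dx) \<times> (real^'dy) \<Rightarrow> real) \<Rightarrow> (real^'dx) \<times> (real^'dy) \<Rightarrow> real^'dy^'dx" where
  "hess_xy h = (\<lambda>(x, y). transpose (jacobian (\<lambda>u. grad_y h (u, y)) (at x)))"

definition hess_yy :: "((real^'dx) \<times> (real^'dy) \<Rightarrow> real) \<Rightarrow> (real^'dx) \<times> (real^'dy) \<Rightarrow> real^'dy^'dy" where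
  "hess_yy h = (\<lambda>(x, y). jacobian (\<lambda>v. grad_y h (x, v)) (at y))"

text \<open>
  The norm on matrices is the operator norm; the norm of the type \<open>real^'n^'m\<close> would be the
  Frobenius norm.
\<close>

definition matrix_lipschitz :: "real \<Rightarrow> ('a::metric_space \<Rightarrow> real^'n^'m) \<Rightarrow> bool" where
  "matrix_lipschitz M A \<longleftrightarrow> (\<forall>p q. onorm ((*v) (A p - A q)) \<le> M * dist p q)"

definition smooth_fun :: "real \<Rightarrow> ('a::real_inner \<Rightarrow> real) \<Rightarrow> bool" where
  "smooth_fun L h \<longleftrightarrow> (\<forall>x. h differentiable (at x)) \<and> L-lipschitz_on UNIV (grad h)"

definition strongly_convex :: "real \<Rightarrow> ('a::real_inner \<Rightarrow> real) \<Rightarrow> bool" where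
  "strongly_convex m h \<longleftrightarrow> convex_on UNIV (\<lambda>x. h x - m / 2 * (norm x)\<^sup>2)"

definition twice_differentiable :: "('a::real_inner \<Rightarrow> real) \<Rightarrow> bool" where
  "twice_differentiable h \<longleftrightarrow>
     (\<forall>x. h differentiable (at x)) \<and> (\<forall>x. grad h differentiable (at x))"


section \<open>The bilevel problem\<close>

definition y_star :: "((real^'dx) \<times> (real^'dy) \<Rightarrow> real) \<Rightarrow> real^'dx \<Rightarrow> real^'dy" where
  "y_star g x = arg_min_on (\<lambda>y. g (x, y)) UNIV"

definition z_star :: "((real^'dx) \<times> (real^'dy) \<Rightarrow> real) \<Rightarrow> ((real^'dx) \<times> (real^'dy) \<Rightarrow> real) \<Rightarrow>
    (real^'dx) \<times> (real^'dy) \<Rightarrow> real^'dy" where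
  "z_star f g p = - (matrix_inv (hess_yy g p) *v grad_y f p)"

definition outer_obj :: "((real^'dx) \<times> (real^'dy) \<Rightarrow> real) \<Rightarrow> ((real^'dx) \<times> (real^'dy) \<Rightarrow> real) \<Rightarrow>
    real^'dx \<Rightarrow> real" where
  "outer_obj f g x = f (x, y_star g x)"


section \<open>Deterministic AmIGO\<close>

definition inner_y :: "((real^'dx) \<times> (real^'dy) \<Rightarrow> real) \<Rightarrow> real \<Rightarrow> nat \<Rightarrow>
    real^'dx \<Rightarrow> real^'dy \<Rightarrow> real^'dy" where
  "inner_y g \<alpha> T x = ((\<lambda>y. y - \<alpha> *\<^sub>R grad_y g (x, y)) ^^ T)"

definition inner_z :: "((real^'dx) \<times> (real^'dy) \<Rightarrow> real) \<Rightarrow> ((real^'dx) \<times> (real^'dy) \<Rightarrow> real) \<Rightarrow>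
    real \<Rightarrow> nat \<Rightarrow> (real^'dx) \<times> (real^'dy) \<Rightarrow> real^'dy \<Rightarrow> real^'dy" where
  "inner_z f g \<beta> N p = ((\<lambda>z. z - \<beta> *\<^sub>R (hess_yy g p *v z + grad_y f p)) ^^ N)"

text \<open>
  \<open>amigo f g \<alpha> \<beta> \<gamma> T N x\<^sub>0 y' z' k\<close> is the triple of \<open>x\<^sub>k\<close> and the two warm starts
  \<open>y\<close> and \<open>z\<close> of index \<open>k - 1\<close>; the initial warm starts \<open>y'\<close> and \<open>z'\<close> have index \<open>-1\<close>.
\<close>

primrec amigo :: "((real^'dx) \<times> (real^'dy) \<Rightarrow> real) \<Rightarrow> ((real^'dx) \<times> (real^'dy) \<Rightarrow> real) \<Rightarrow>
    (nat \<Rightarrow> real) \<Rightarrow> (nat \<Rightarrow> real) \<Rightarrow> (nat \<Rightarrow> real) \<Rightarrow> nat \<Rightarrow> nat \<Rightarrow>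
    real^'dx \<Rightarrow> real^'dy \<Rightarrow> real^'dy \<Rightarrow> nat \<Rightarrow> (real^'dx) \<times> (real^'dy) \<times> (real^'dy)" where
  "amigo f g \<alpha> \<beta> \<gamma> T N x0 y' z' 0 = (x0, y', z')"
| "amigo f g \<alpha> \<beta> \<gamma> T N x0 y' z' (Suc k) =
     (let (x, y_prev, z_prev) = amigo f g \<alpha> \<beta> \<gamma> T N x0 y' z' k;
          y = inner_y g (\<alpha> k) T x y_prev;
          z = inner_z f g (\<beta> k) N (x, y) z_prev;
          \<psi> = grad_x f (x, y) + hess_xy g (x, y) *v z
      in (x - \<gamma> (Suc k) *\<^sub>R \<psi>, y, z))"

definition amigo_x :: "((real^'dx) \<times> (real^'dy) \<Rightarrow> real) \<Rightarrow> ((real^'dx) \<times> (real^'dy) \<Rightarrow> real) \<Rightarrow>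
    (nat \<Rightarrow> real) \<Rightarrow> (nat \<Rightarrow> real) \<Rightarrow> (nat \<Rightarrow> real) \<Rightarrow> nat \<Rightarrow> nat \<Rightarrow>
    real^'dx \<Rightarrow> real^'dy \<Rightarrow> real^'dy \<Rightarrow> nat \<Rightarrow> real^'dx" where
  "amigo_x f g \<alpha> \<beta> \<gamma> T N x0 y' z' k = fst (amigo f g \<alpha> \<beta> \<gamma> T N x0 y' z' k)"

definition init_err_y :: "((real^'dx) \<times> (real^'dy) \<Rightarrow> real) \<Rightarrow> real^'dx \<Rightarrow> real^'dy \<Rightarrow> real" where
  "init_err_y g x0 y' = (norm (y' - y_star g x0))\<^sup>2"

text \<open>The second error refers to \<open>y\<^sub>0\<close>, the result of the first \<open>T\<close> inner steps.\<close>

definition init_err_z :: "((real^'dx) \<times> (real^'dy) \<Rightarrow> real) \<Rightarrow> ((real^'dx) \<times> (real^'dy) \<Rightarrow> real) \<Rightarrow>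
    real \<Rightarrow> nat \<Rightarrow> real^'dx \<Rightarrow> real^'dy \<Rightarrow> real^'dy \<Rightarrow> real" where
  "init_err_z f g \<alpha>\<^sub>0 T x0 y' z' = (norm (z' - z_star f g (x0, inner_y g \<alpha>\<^sub>0 T x0 y')))\<^sup>2"

definition complexity :: "nat \<Rightarrow> nat \<Rightarrow> nat \<Rightarrow> nat \<Rightarrow> nat \<Rightarrow> nat \<Rightarrow> nat \<Rightarrow> nat" where
  "complexity Dg Dgyy Dgxy Df T N k = k * (T * Dg + N * Dgyy + Dgxy + Df)"


section \<open>Constants\<close>

definition Ly_const :: "real \<Rightarrow> real \<Rightarrow> real" where
  "Ly_const Lg' \<mu>g = Lg' / \<mu>g"

definition Lz_const :: "real \<Rightarrow> real \<Rightarrow> real \<Rightarrow> real \<Rightarrow> real" where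
  "Lz_const Lf B Mg \<mu>g = Mg * B / \<mu>g\<^sup>2 + Lf / \<mu>g"

definition Lpsi_const :: "real \<Rightarrow> real \<Rightarrow> real \<Rightarrow> real \<Rightarrow> real \<Rightarrow> real" where
  "Lpsi_const Lf B Lg' Mg \<mu>g =
     max (Lf + Mg * B / \<mu>g + Lg' * Lz_const Lf B Mg \<mu>g) Lg'"

definition L_const :: "real \<Rightarrow> real \<Rightarrow> real \<Rightarrow> real \<Rightarrow> real \<Rightarrow> real" where
  "L_const Lf B Lg' Mg \<mu>g =
     (Lf + Lg' * Mg * B / \<mu>g\<^sup>2 + (Lg' * Lf + Mg * B) / \<mu>g) * (1 + Lg' / \<mu>g)"

text \<open>The maxima of \<open>C\<^sub>1, C\<^sub>2, C\<^sub>3\<close> and of their primed counterparts.\<close>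

definition C_const :: "real \<Rightarrow> real \<Rightarrow> real \<Rightarrow> real \<Rightarrow> real \<Rightarrow> real" where
  "C_const Lf B Lg' Mg \<mu>g =
     (let Ly = Ly_const Lg' \<mu>g; L\<psi> = Lpsi_const Lf B Lg' Mg \<mu>g; L = L_const Lf B Lg' Mg \<mu>g;
          \<eta>\<^sub>0 = L; \<zeta>\<^sub>0 = 2 * L;
          C1 = 1 + 2 * ln (6 + 24 * L\<psi>\<^sup>2 / \<eta>\<^sub>0);
          C2 = 2 * ln (1 + 4 * Ly\<^sup>2 / L\<^sup>2 * max \<eta>\<^sub>0 (8 * \<zeta>\<^sub>0));
          C3 = Max {0, - 2 * ln (5 * L\<psi>\<^sup>2 / \<eta>\<^sub>0), - 2 * ln (L / (4 * Ly\<^sup>2))}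
      in Max {C1, C2, C3})"

definition C'_const :: "real \<Rightarrow> real \<Rightarrow> real \<Rightarrow> real \<Rightarrow> real \<Rightarrow> real" where
  "C'_const Lf B Lg' Mg \<mu>g =
     (let Ly = Ly_const Lg' \<mu>g; Lz = Lz_const Lf B Mg \<mu>g;
          L\<psi> = Lpsi_const Lf B Lg' Mg \<mu>g; L = L_const Lf B Lg' Mg \<mu>g;
          \<eta>\<^sub>0 = L; \<gamma> = 1 / L;
          C1 = 1 + 2 * ln (4 + 24 * L\<psi>\<^sup>2 / \<eta>\<^sub>0);
          C2 = 2 * ln (1 + 2 * Lz\<^sup>2 / Ly\<^sup>2 * (1 + 16 * Ly\<^sup>2));
          C3 = Max {0, - 2 * ln (L\<psi>\<^sup>2 / (4 * Lz\<^sup>2 * \<eta>\<^sub>0)), - 2 * ln (\<gamma> * Lg'\<^sup>2)}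
      in Max {C1, C2, C3})"

definition T_iter :: "real \<Rightarrow> real \<Rightarrow> real \<Rightarrow> real \<Rightarrow> real \<Rightarrow> real \<Rightarrow> nat" where
  "T_iter Lf B Lg Lg' Mg \<mu>g =
     (let \<alpha> = 1 / Lg in nat \<lfloor>1 / \<alpha> * (1 / \<mu>g) * C_const Lf B Lg' Mg \<mu>g\<rfloor> + 1)"

definition N_iter :: "real \<Rightarrow> real \<Rightarrow> real \<Rightarrow> real \<Rightarrow> real \<Rightarrow> real \<Rightarrow> nat" where
  "N_iter Lf B Lg Lg' Mg \<mu>g =
     (let \<beta> = 1 / (2 * Lg)
      in nat \<lfloor>2 * (1 / \<beta>) * (1 / \<mu>g) * (C_const Lf B Lg' Mg \<mu>g + C'_const Lf B Lg' Mg \<mu>g)\<rfloor> + 1)"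

text \<open>
  The constants hidden in the \<open>O\<close>-notation. They depend on \<open>Lf, B, Lg, Lg', Mg\<close> only, and neither
  on \<open>\<mu>g\<close> nor on the dimensions. They are explicit because the dimensions are types: a constant
  bound by an existential quantifier inside a theorem could vary with them. Both are assembled
  from the constants above at \<open>\<mu>g = Lg\<close>, that is, at condition number 1. For condition number
  \<open>\<kappa> = Lg / \<mu>g\<close> instead, \<open>L_const\<close> is larger by a factor of at most \<open>\<kappa>\<^sup>3\<close>, and \<open>C_const\<close> and
  \<open>C'_const\<close> are larger by at most a fixed multiple of \<open>ln \<kappa>\<close>. The numerical factors are not
  optimised.
\<close>

definition inner_O_const :: "real \<Rightarrow> real \<Rightarrow> real \<Rightarrow> real \<Rightarrow> real \<Rightarrow> real" where
  "inner_O_const Lf B Lg Lg' Mg = 100 * (1 + C_const Lf B Lg' Mg Lg + C'_const Lf B Lg' Mg Lg)"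

definition complexity_O_const :: "real \<Rightarrow> real \<Rightarrow> real \<Rightarrow> real \<Rightarrow> real \<Rightarrow> real" where
  "complexity_O_const Lf B Lg Lg' Mg =
     100 * L_const Lf B Lg' Mg Lg * inner_O_const Lf B Lg Lg' Mg"

end

theory Submission
  imports Defs
begin

text \<open>
  By strong convexity and cocoercivity every inner step contracts the squared distance to its
  target, \<open>y\<^sup>\<star>(x)\<close> or \<open>z\<^sup>\<star>(x, y)\<close>, by a factor \<open>1 - c / \<kappa>\<close>; the choice of \<open>T\<close> and \<open>N\<close> turns this
  into total factors \<open>\<Lambda>\<close> and \<open>\<Theta>\<close> that beat all the constants \<open>L\<^sub>\<psi>\<^sup>2 / L\<close>, \<open>L\<^sub>y\<^sup>2 / L\<close> and \<open>L\<^sub>z\<^sup>2\<close>. Since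
  \<open>y\<^sup>\<star>\<close> and \<open>z\<^sup>\<star>\<close> are Lipschitz, the warm starts make the errors at step \<open>k + 1\<close> at most a small
  multiple of those at step \<open>k\<close> plus a multiple of the squared outer step. Summation of these
  recursions and of the descent inequality for the \<open>L\<close>-smooth outer objective bounds the sum of
  the squared gradients by \<open>4 L ((\<L>(x\<^sub>0) - \<L>\<^sup>\<star>) + E\<^sub>y + E\<^sub>z)\<close>. Finally \<open>L\<close> grows at most like \<open>\<kappa>\<^sup>3\<close>,
  and \<open>T\<close> and \<open>N\<close> at most like \<open>\<kappa> ln \<kappa>\<close>.
\<close>

section \<open>Gradients of smooth and strongly convex functions\<close>

text \<open>\<open>C\<close> and \<open>C'\<close> are maxima of logarithms rather than sums,
  whereas the recursion needs products of several constants to be beaten. The factor 2 in front of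
  the logarithms resolves this: two quantities below \<open>exp (c / 2)\<close> have a product below
  \<open>exp c\<close>. The sum \<open>C + C'\<close> in \<open>N\<close> supplies a second
  exponential: the one with \<open>C'\<close> handles \<open>L\<^sub>\<psi>\<close> and
  \<open>L\<^sub>z\<close> but leaves a factor \<open>L\<^sub>y\<^sup>2\<close>, which the one with
  \<open>C\<close> removes.

  The recursion is circular, since the errors depend on the outer steps, and those on the gradients
  and again on the errors. It is closed only after summation, where it becomes a system of linear
  inequalities in a few sums; no Lyapunov function is built.

  Differentiability of \<open>y_star\<close> is not assumed. It follows from Lipschitz continuity of
  \<open>y_star\<close> and the linearised stationarity condition. The exponent in
  \<open>\<kappa> ^ 4\<close> is 3 from \<open>L\<close>, to which the number of outer iterations is
  proportional up to rounding, plus 1 from the inner loops.\<close>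

lemma grad_eqI:
  fixes h :: "'a::real_inner \<Rightarrow> real"
  assumes "(h has_derivative (\<lambda>v. v \<bullet> D)) (at x)"
  shows "grad h x = D"
  unfolding grad_def
proof (rule the_equality)
  show "GDERIV h x :> D" using assms by (simp add: gderiv_def)
  fix E assume "GDERIV h x :> E"
  then have "(\<lambda>v. v \<bullet> E) = (\<lambda>v. v \<bullet> D)"
    using assms has_derivative_unique by (auto simp: gderiv_def)
  then have "(E - D) \<bullet> E = (E - D) \<bullet> D" by metis
  then have "(E - D) \<bullet> (E - D) = 0" by (simp add: inner_diff_right)
  then show "E = D" by simp
qed

text \<open>Riesz representation in an orthonormal basis: \<open>h'\<close> is the inner product
  with the vector whose coordinates are the values of \<open>h'\<close> on \<open>Basis\<close>.
  This makes the \<open>THE\<close> in \<open>grad\<close> denote.\<close>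

lemma has_derivative_grad:
  fixes h :: "'a::euclidean_space \<Rightarrow> real"
  assumes "h differentiable (at x)"
  shows "(h has_derivative (\<lambda>v. v \<bullet> grad h x)) (at x)"
proof -
  obtain h' where h': "(h has_derivative h') (at x)"
    using assms by (auto simp: differentiable_def)
  have "h' v = v \<bullet> (\<Sum>b\<in>Basis. h' b *\<^sub>R b)" for v
  proof -
    have lin: "linear h'" using h' has_derivative_linear by blast
    have "h' v = h' (\<Sum>b\<in>Basis. (v \<bullet> b) *\<^sub>R b)" by (simp add: euclidean_representation)
    also have "\<dots> = (\<Sum>b\<in>Basis. (v \<bullet> b) * h' b)"
      using lin by (simp add: linear_sum linear_cmul)
    also have "\<dots> = v \<bullet> (\<Sum>b\<in>Basis. h' b *\<^sub>R b)"
      by (simp add: inner_sum_right mult.commute)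
    finally show ?thesis .
  qed
  then have h'_eq: "h' = (\<lambda>v. v \<bullet> (\<Sum>b\<in>Basis. h' b *\<^sub>R b))" by blast
  with h' have *: "(h has_derivative (\<lambda>v. v \<bullet> (\<Sum>b\<in>Basis. h' b *\<^sub>R b))) (at x)" by simp
  show ?thesis using grad_eqI[OF *] * by simp
qed

lemma has_real_derivative_along_line:
  fixes h :: "'a::euclidean_space \<Rightarrow> real"
  assumes "\<And>x. h differentiable (at x)"
  shows "((\<lambda>t. h (a + t *\<^sub>R v)) has_real_derivative grad h (a + t *\<^sub>R v) \<bullet> v) (at t)"
proof -
  have "((\<lambda>t. h (a + t *\<^sub>R v)) has_derivative (\<lambda>s. (s *\<^sub>R v) \<bullet> grad h (a + t *\<^sub>R v))) (at t)"
    by (rule has_derivative_compose[of "\<lambda>t. a + t *\<^sub>R v" "\<lambda>s. s *\<^sub>R v" t UNIV h, simplified])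
      (auto intro!: derivative_eq_intros has_derivative_grad assms)
  moreover have "(\<lambda>s. (s *\<^sub>R v) \<bullet> grad h (a + t *\<^sub>R v)) = (*) (grad h (a + t *\<^sub>R v) \<bullet> v)"
    by (simp add: fun_eq_iff inner_commute)
  ultimately show ?thesis by (simp add: has_field_derivative_def)
qed

text \<open>The gap \<open>\<phi>\<close> between \<open>h\<close> on the segment and its quadratic
  model is nonincreasing, because the Lipschitz bound on the gradient makes its derivative
  nonpositive.\<close>

lemma smooth_fun_upper_bound:
  fixes h :: "'a::euclidean_space \<Rightarrow> real"
  assumes "smooth_fun L h"
  shows "h b \<le> h a + grad h a \<bullet> (b - a) + L / 2 * (norm (b - a))\<^sup>2"
proof -
  define v where "v = b - a"
  define \<phi> where "\<phi> t = h (a + t *\<^sub>R v) - t * (grad h a \<bullet> v) - L / 2 * t\<^sup>2 * (norm v)\<^sup>2" for t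
  have diff: "\<And>x. h differentiable (at x)" and lip: "L-lipschitz_on UNIV (grad h)"
    using assms by (auto simp: smooth_fun_def)
  have "\<phi> 1 \<le> \<phi> 0"
  proof (rule DERIV_nonpos_imp_nonincreasing[of 0 1 \<phi>])
    fix t :: real assume t: "0 \<le> t" "t \<le> 1"
    have "(\<phi> has_real_derivative
        (grad h (a + t *\<^sub>R v) \<bullet> v - grad h a \<bullet> v - L * t * (norm v)\<^sup>2)) (at t)"
      unfolding \<phi>_def
      by (rule derivative_eq_intros has_real_derivative_along_line diff refl | simp)+
    moreover have "grad h (a + t *\<^sub>R v) \<bullet> v - grad h a \<bullet> v \<le> L * t * (norm v)\<^sup>2"
    proof -
      have "(grad h (a + t *\<^sub>R v) - grad h a) \<bullet> v \<le> norm (grad h (a + t *\<^sub>R v) - grad h a) * norm v"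
        by (rule norm_cauchy_schwarz)
      also have "\<dots> \<le> (L * (t * norm v)) * norm v"
        using lipschitz_onD[OF lip, of "a + t *\<^sub>R v" a] t
        by (intro mult_right_mono) (auto simp: dist_norm)
      finally show ?thesis by (simp add: inner_diff_left power2_eq_square mult_ac)
    qed
    ultimately show "\<exists>y. (\<phi> has_real_derivative y) (at t) \<and> y \<le> 0" by force
  qed auto
  then show ?thesis by (simp add: \<phi>_def v_def)
qed

text \<open>On the segment, \<open>h\<close> minus the quadratic is a convex function of one
  variable and lies above its tangent at 0; expanding the squared norm around \<open>a\<close>
  restores the quadratic term.\<close>

lemma strongly_convex_lower_bound:
  fixes h :: "'a::euclidean_space \<Rightarrow> real"
  assumes diff: "\<And>x. h differentiable (at x)" and conv: "strongly_convex m h"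
  shows "h b \<ge> h a + grad h a \<bullet> (b - a) + m / 2 * (norm (b - a))\<^sup>2"
proof -
  define v where "v = b - a"
  define k where "k = (\<lambda>x. h x - m / 2 * (norm x)\<^sup>2)"
  define \<phi> where "\<phi> t = k (a + t *\<^sub>R v)" for t :: real
  have k: "convex_on UNIV k" using conv by (simp add: strongly_convex_def k_def)
  have "convex_on UNIV \<phi>"
  proof (rule convex_onI)
    fix t x y :: real assume "0 < t" "t < 1"
    then have "k ((1 - t) *\<^sub>R (a + x *\<^sub>R v) + t *\<^sub>R (a + y *\<^sub>R v))
        \<le> (1 - t) * k (a + x *\<^sub>R v) + t * k (a + y *\<^sub>R v)"
      using convex_onD[OF k, of t "a + x *\<^sub>R v" "a + y *\<^sub>R v"] by simp
    moreover have "(1 - t) *\<^sub>R (a + x *\<^sub>R v) + t *\<^sub>R (a + y *\<^sub>R v)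
        = a + ((1 - t) *\<^sub>R x + t *\<^sub>R y) *\<^sub>R v"
      by (simp add: algebra_simps)
    ultimately show "\<phi> ((1 - t) *\<^sub>R x + t *\<^sub>R y) \<le> (1 - t) * \<phi> x + t * \<phi> y"
      by (simp add: \<phi>_def)
  qed simp
  moreover have "(\<phi> has_real_derivative grad h a \<bullet> v - m * (a \<bullet> v)) (at 0)"
  proof -
    have eq: "\<phi> = (\<lambda>t. h (a + t *\<^sub>R v)
        - m / 2 * ((norm a)\<^sup>2 + 2 * t * (a \<bullet> v) + t\<^sup>2 * (norm v)\<^sup>2))"
      unfolding \<phi>_def k_def power2_norm_eq_inner
      by (simp add: fun_eq_iff inner_add_left inner_add_right inner_commute power2_eq_square
          algebra_simps)
    show ?thesis unfolding eq
      by (rule derivative_eq_intros has_real_derivative_along_line diff refl | simp)+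
  qed
  ultimately have "\<phi> 1 - \<phi> 0 \<ge> (grad h a \<bullet> v - m * (a \<bullet> v)) * (1 - 0)"
    by (intro convex_on_imp_above_tangent[of UNIV]) auto
  then have "k b - k a \<ge> grad h a \<bullet> v - m * (a \<bullet> v)" by (simp add: \<phi>_def v_def)
  moreover have "(norm b)\<^sup>2 = (norm a)\<^sup>2 + 2 * (a \<bullet> v) + (norm v)\<^sup>2"
    unfolding v_def power2_norm_eq_inner
    by (simp add: inner_diff_left inner_diff_right inner_commute)
  ultimately have "h b \<ge> h a + grad h a \<bullet> v + m / 2 * (norm v)\<^sup>2"
    by (simp add: k_def algebra_simps add_divide_distrib)
  then show ?thesis by (simp add: v_def)
qed

text \<open>Two lower bounds with \<open>a\<close> and \<open>b\<close> exchanged are added; the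
  function values cancel.\<close>

lemma strongly_convex_grad_monotone:
  fixes h :: "'a::euclidean_space \<Rightarrow> real"
  assumes "\<And>x. h differentiable (at x)" "strongly_convex m h"
  shows "(grad h a - grad h b) \<bullet> (a - b) \<ge> m * (norm (a - b))\<^sup>2"
  using strongly_convex_lower_bound[OF assms, of a b] strongly_convex_lower_bound[OF assms, of b a]
  by (simp add: inner_diff_left inner_diff_right norm_minus_commute)

text \<open>Needed with \<open>m' = 0\<close>, to treat the strongly convex slices of
  \<open>g\<close> as merely convex ones in the cocoercivity estimate.\<close>

lemma strongly_convex_mono:
  fixes h :: "'a::real_inner \<Rightarrow> real"
  assumes "strongly_convex m h" "m' \<le> m"
  shows "strongly_convex m' h"
proof -
  have "convex_on UNIV (\<lambda>x::'a. (norm x)\<^sup>2)"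
  proof (rule convex_onI)
    fix t :: real and x y :: 'a assume t: "0 < t" "t < 1"
    have "(norm ((1 - t) *\<^sub>R x + t *\<^sub>R y))\<^sup>2
        = (1 - t) * (norm x)\<^sup>2 + t * (norm y)\<^sup>2 - t * (1 - t) * (norm (x - y))\<^sup>2"
      unfolding power2_norm_eq_inner
      by (simp add: inner_add_left inner_add_right inner_diff_left inner_diff_right
          inner_commute algebra_simps)
    then show "(norm ((1 - t) *\<^sub>R x + t *\<^sub>R y))\<^sup>2 \<le> (1 - t) * (norm x)\<^sup>2 + t * (norm y)\<^sup>2"
      using t by simp
  qed simp
  then have "convex_on UNIV (\<lambda>x::'a. (m - m') / 2 * (norm x)\<^sup>2)"
    using assms by (intro convex_on_cmul) auto
  then have "convex_on UNIV (\<lambda>x. (h x - m / 2 * (norm x)\<^sup>2) + (m - m') / 2 * (norm x)\<^sup>2)"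
    using assms by (intro convex_on_add) (auto simp: strongly_convex_def)
  also have "(\<lambda>x. (h x - m / 2 * (norm x)\<^sup>2) + (m - m') / 2 * (norm x)\<^sup>2)
      = (\<lambda>x. h x - m' / 2 * (norm x)\<^sup>2)"
    by (simp add: fun_eq_iff field_simps)
  finally show ?thesis by (simp only: strongly_convex_def)
qed

text \<open>The lower bound at \<open>a\<close> is compared with the upper bound for a gradient step from \<open>b\<close>,
  both for \<open>h\<close> minus its linearisation at \<open>a\<close>.\<close>
lemma smooth_convex_lower_bound:
  fixes h :: "'a::euclidean_space \<Rightarrow> real"
  assumes "0 < L" and smooth: "smooth_fun L h" and conv: "strongly_convex 0 h"
  shows "h b \<ge> h a + grad h a \<bullet> (b - a) + 1 / (2 * L) * (norm (grad h b - grad h a))\<^sup>2"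
proof -
  define d where "d = grad h b - grad h a"
  define c where "c = b - (1 / L) *\<^sub>R d"
  have diff: "\<And>x. h differentiable (at x)" using smooth by (simp add: smooth_fun_def)
  have "h a + grad h a \<bullet> (c - a) \<le> h c"
    using strongly_convex_lower_bound[OF diff conv, of a c] by simp
  also have "\<dots> \<le> h b + grad h b \<bullet> (c - b) + L / 2 * (norm (c - b))\<^sup>2"
    by (rule smooth_fun_upper_bound[OF smooth])
  finally have "h a + grad h a \<bullet> (c - a) \<le> h b + grad h b \<bullet> (c - b) + L / 2 * (norm (c - b))\<^sup>2" .
  moreover have "grad h a \<bullet> (c - a) = grad h a \<bullet> (b - a) - (grad h a \<bullet> d) / L"
    by (simp add: c_def inner_diff_right)
  moreover have "grad h b \<bullet> (c - b) = - (grad h b \<bullet> d) / L" by (simp add: c_def)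
  moreover have "L / 2 * (norm (c - b))\<^sup>2 = 1 / (2 * L) * (norm d)\<^sup>2"
    using \<open>0 < L\<close> by (simp add: c_def power_divide power2_eq_square)
  moreover have "grad h b \<bullet> d = grad h a \<bullet> d + (norm d)\<^sup>2"
    by (simp add: d_def power2_norm_eq_inner inner_diff_left)
  moreover have "1 / (2 * L) * (norm d)\<^sup>2 = (norm d)\<^sup>2 / L / 2" by simp
  ultimately have "h a + (grad h a \<bullet> (b - a) - (grad h a \<bullet> d) / L)
      \<le> h b - (grad h a \<bullet> d) / L - (norm d)\<^sup>2 / L + (norm d)\<^sup>2 / L / 2"
    by (simp add: add_divide_distrib diff_divide_distrib)
  then have "h a + grad h a \<bullet> (b - a) + (norm d)\<^sup>2 / L / 2 \<le> h b" by linarith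
  then show ?thesis by (simp add: d_def)
qed

lemma smooth_convex_grad_cocoercive:
  fixes h :: "'a::euclidean_space \<Rightarrow> real"
  assumes "0 < L" "smooth_fun L h" "strongly_convex 0 h"
  shows "(norm (grad h a - grad h b))\<^sup>2 \<le> L * ((grad h a - grad h b) \<bullet> (a - b))"
  using smooth_convex_lower_bound[OF assms, of a b] smooth_convex_lower_bound[OF assms, of b a]
    \<open>0 < L\<close>
  by (simp add: inner_diff_left inner_diff_right norm_minus_commute field_simps)

text \<open>Cocoercivity absorbs the quadratic term \<open>c\<^sup>2 * (norm d)\<^sup>2\<close> into
  the linear one, leaving \<open>- (2 - c * L) * c * (d \<bullet> w)\<close>, to which monotonicity
  applies. As \<open>d\<close> is an arbitrary vector, this covers gradient differences in the
  \<open>y\<close> loop and Hessian images in the \<open>z\<close> loop.\<close>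

lemma norm_step_contraction:
  fixes w d :: "'a::real_inner"
  assumes mono: "m * (norm w)\<^sup>2 \<le> d \<bullet> w" and coco: "(norm d)\<^sup>2 \<le> L * (d \<bullet> w)"
    and c: "0 \<le> c" "c * L \<le> 2"
  shows "(norm (w - c *\<^sub>R d))\<^sup>2 \<le> (1 - (2 - c * L) * c * m) * (norm w)\<^sup>2"
proof -
  have "(norm (w - c *\<^sub>R d))\<^sup>2 = (norm w)\<^sup>2 - 2 * c * (d \<bullet> w) + c\<^sup>2 * (norm d)\<^sup>2"
    unfolding power2_norm_eq_inner
    by (simp add: inner_diff_left inner_diff_right inner_commute power2_eq_square algebra_simps)
  also have "\<dots> \<le> (norm w)\<^sup>2 - 2 * c * (d \<bullet> w) + c\<^sup>2 * (L * (d \<bullet> w))"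
    using coco by (simp add: mult_left_mono)
  also have "\<dots> = (norm w)\<^sup>2 - ((2 - c * L) * c) * (d \<bullet> w)"
    by (simp add: power2_eq_square algebra_simps)
  also have "\<dots> \<le> (norm w)\<^sup>2 - ((2 - c * L) * c) * (m * (norm w)\<^sup>2)"
    using mono c by (intro diff_left_mono mult_left_mono) auto
  finally show ?thesis by (simp add: algebra_simps)
qed

text \<open>The second difference of \<open>h\<close> over the parallelogram spanned by \<open>t u\<close> and \<open>t v\<close> is
  \<open>t\<^sup>2 (H v \<bullet> u) + o(t\<^sup>2)\<close>, and it is symmetric in \<open>u\<close> and \<open>v\<close>.\<close>
lemma hessian_symmetric:
  fixes h :: "'a::euclidean_space \<Rightarrow> real"
  assumes diff: "\<And>x. h differentiable (at x)"
    and hess: "(grad h has_derivative H) (at y)"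
  shows "H v \<bullet> u = H u \<bullet> v"
proof -
  define K where "K = norm u + norm v"
  have K: "0 \<le> K" "norm u \<le> K" "norm v \<le> K" by (auto simp: K_def)
  define \<Delta> where "\<Delta> t = h (y + t *\<^sub>R u + t *\<^sub>R v) - h (y + t *\<^sub>R u) - h (y + t *\<^sub>R v) + h y" for t
  have lin: "linear H" using hess has_derivative_linear by blast
  \<comment> \<open>One mean value theorem in direction \<open>a\<close> reduces the second
    difference to gradients; differentiability of \<open>grad h\<close> at the single point
    \<open>y\<close> does the rest. \<open>\<Delta>\<close> is symmetric in \<open>u\<close> and
    \<open>v\<close>, so the same estimate serves both orders.\<close>
  have est: "\<bar>\<Delta> t / t\<^sup>2 - H b \<bullet> a\<bar> \<le> 2 * e * K * norm a"
    if ab: "(a = u \<and> b = v) \<or> (a = v \<and> b = u)" and t: "0 < t" and e: "0 < e"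
      and bound: "\<And>w. norm w \<le> t * K \<Longrightarrow> norm (grad h (y + w) - grad h y - H w) \<le> e * norm w"
    for a b t e
  proof -
    define \<phi> where "\<phi> s = h ((y + t *\<^sub>R b) + s *\<^sub>R a) - h (y + s *\<^sub>R a)" for s
    have "\<And>s. (\<phi> has_real_derivative
        (grad h ((y + t *\<^sub>R b) + s *\<^sub>R a) \<bullet> a - grad h (y + s *\<^sub>R a) \<bullet> a)) (at s)"
      unfolding \<phi>_def
      by (intro derivative_intros has_real_derivative_along_line diff)
    from MVT2[OF t this] obtain \<xi> where \<xi>: "0 < \<xi>" "\<xi> < t"
      and mvt: "\<phi> t - \<phi> 0 = (t - 0) * (grad h ((y + t *\<^sub>R b) + \<xi> *\<^sub>R a) \<bullet> a - grad h (y + \<xi> *\<^sub>R a) \<bullet> a)"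
      by blast
    define r where "r w = grad h (y + w) - grad h y - H w" for w
    have r: "norm (r w) \<le> e * (t * K)" if "norm w \<le> t * K" for w
      using bound[OF that] mult_left_mono[OF that, of e] e unfolding r_def by linarith
    have "norm (t *\<^sub>R b + \<xi> *\<^sub>R a) \<le> t * norm b + \<xi> * norm a"
      using norm_triangle_ineq[of "t *\<^sub>R b" "\<xi> *\<^sub>R a"] t \<xi> by simp
    also have "\<dots> \<le> t * norm b + t * norm a"
      using \<xi> by (simp add: mult_right_mono)
    also have "\<dots> = t * K" using ab by (auto simp: K_def algebra_simps)
    finally have r1: "norm (r (t *\<^sub>R b + \<xi> *\<^sub>R a)) \<le> e * (t * K)" by (rule r)
    have "\<xi> * norm a \<le> t * K" using \<xi> ab K by (intro mult_mono) auto
    then have r2: "norm (r (\<xi> *\<^sub>R a)) \<le> e * (t * K)" using \<xi> by (intro r) simp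
    have "grad h ((y + t *\<^sub>R b) + \<xi> *\<^sub>R a) - grad h (y + \<xi> *\<^sub>R a)
        = r (t *\<^sub>R b + \<xi> *\<^sub>R a) - r (\<xi> *\<^sub>R a) + t *\<^sub>R H b"
      using lin by (simp add: r_def linear_add linear_cmul algebra_simps)
    then have "grad h ((y + t *\<^sub>R b) + \<xi> *\<^sub>R a) \<bullet> a - grad h (y + \<xi> *\<^sub>R a) \<bullet> a
        = (r (t *\<^sub>R b + \<xi> *\<^sub>R a) - r (\<xi> *\<^sub>R a)) \<bullet> a + t * (H b \<bullet> a)"
      by (metis inner_add_left inner_diff_left inner_scaleR_left)
    then have "\<phi> t - \<phi> 0 = t * ((r (t *\<^sub>R b + \<xi> *\<^sub>R a) - r (\<xi> *\<^sub>R a)) \<bullet> a) + t\<^sup>2 * (H b \<bullet> a)"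
      unfolding mvt by (simp only: power2_eq_square distrib_left diff_0_right mult.assoc)
    moreover have "\<phi> t - \<phi> 0 = \<Delta> t"
      using ab by (auto simp: \<phi>_def \<Delta>_def algebra_simps)
    ultimately have "\<Delta> t / t\<^sup>2 - H b \<bullet> a = ((r (t *\<^sub>R b + \<xi> *\<^sub>R a) - r (\<xi> *\<^sub>R a)) \<bullet> a) / t"
      using t by (simp add: field_simps power2_eq_square)
    moreover have "\<bar>(r (t *\<^sub>R b + \<xi> *\<^sub>R a) - r (\<xi> *\<^sub>R a)) \<bullet> a\<bar> \<le> (2 * (e * (t * K))) * norm a"
    proof -
      have "norm (r (t *\<^sub>R b + \<xi> *\<^sub>R a) - r (\<xi> *\<^sub>R a)) \<le> 2 * (e * (t * K))"
        using norm_triangle_ineq4[of "r (t *\<^sub>R b + \<xi> *\<^sub>R a)" "r (\<xi> *\<^sub>R a)"] r1 r2 by linarith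
      then show ?thesis
        by (meson Cauchy_Schwarz_ineq2 mult_right_mono norm_ge_zero order_trans)
    qed
    ultimately have "\<bar>\<Delta> t / t\<^sup>2 - H b \<bullet> a\<bar> \<le> (2 * (e * (t * K))) * norm a / t"
      using t by (simp only: abs_divide abs_of_pos divide_right_mono less_imp_le)
    then show ?thesis using t by simp
  qed
  have "\<bar>H v \<bullet> u - H u \<bullet> v\<bar> \<le> 0"
  proof (rule field_le_epsilon)
    fix \<epsilon> :: real assume "0 < \<epsilon>"
    \<comment> \<open>The added 1 in this denominator, and in that of \<open>t\<close> below, covers
      the case \<open>K = 0\<close>.\<close>
    define e where "e = \<epsilon> / (2 * K\<^sup>2 + 1)"
    have pos: "0 < 2 * K\<^sup>2 + 1" using zero_le_power2[of K] by linarith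
    have e: "0 < e" using \<open>0 < \<epsilon>\<close> pos by (simp add: e_def)
    obtain d where d: "0 < d"
      and bd: "\<And>z. norm (z - y) < d \<Longrightarrow> norm (grad h z - grad h y - H (z - y)) \<le> e * norm (z - y)"
      using hess e unfolding has_derivative_at_alt by blast
    define t where "t = d / (K + 1) / 2"
    have t: "0 < t" using d K by (simp add: t_def)
    have "K / (K + 1) < 2" using K(1) by (simp add: field_simps)
    then have tK: "t * K < d" using mult_strict_left_mono[of "K / (K + 1)" 2 "d / 2"] d
      by (simp add: t_def mult_ac)
    have bound: "norm (grad h (y + w) - grad h y - H w) \<le> e * norm w" if "norm w \<le> t * K" for w
      using bd[of "y + w"] that tK by simp
    have "\<bar>\<Delta> t / t\<^sup>2 - H v \<bullet> u\<bar> \<le> 2 * e * K * norm u" "\<bar>\<Delta> t / t\<^sup>2 - H u \<bullet> v\<bar> \<le> 2 * e * K * norm v"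
      using est[of u v t e] est[of v u t e] t e bound by auto
    then have "\<bar>H v \<bullet> u - H u \<bullet> v\<bar> \<le> 2 * e * K * norm u + 2 * e * K * norm v" by linarith
    also have "\<dots> = e * (2 * K\<^sup>2)" by (simp add: K_def power2_eq_square algebra_simps)
    also have "\<dots> \<le> e * (2 * K\<^sup>2 + 1)" using e by (intro mult_left_mono) auto
    also have "\<dots> = \<epsilon>" using pos by (simp add: e_def)
    finally show "\<bar>H v \<bullet> u - H u \<bullet> v\<bar> \<le> 0 + \<epsilon>" by simp
  qed
  then show ?thesis by simp
qed

text \<open>Carries inequalities for difference quotients over to the derivative; the one-sided
  filter allows division by a positive \<open>t\<close>.\<close>

lemma has_derivative_imp_directional_limit:
  fixes F :: "'a::real_normed_vector \<Rightarrow> 'b::real_normed_vector"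
  assumes "(F has_derivative F') (at x)"
  shows "((\<lambda>t. (1 / t) *\<^sub>R (F (x + t *\<^sub>R w) - F x)) \<longlongrightarrow> F' w) (at_right 0)"
proof -
  have lin: "linear F'" using assms has_derivative_linear by blast
  have "((\<lambda>t. F (x + t *\<^sub>R w)) has_derivative (\<lambda>s. F' (s *\<^sub>R w))) (at 0)"
    by (rule has_derivative_compose[of "\<lambda>t. x + t *\<^sub>R w" "\<lambda>s. s *\<^sub>R w" 0 UNIV F F', simplified])
      (auto intro!: derivative_eq_intros assms)
  then have "((\<lambda>t. F (x + t *\<^sub>R w)) has_vector_derivative F' w) (at 0)"
    using lin by (simp add: has_vector_derivative_def linear_cmul)
  then have "((\<lambda>t. F (x + t *\<^sub>R w)) has_vector_derivative F' w) (at_right 0)"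
    by (rule has_vector_derivative_at_within)
  then have *: "((\<lambda>t. (1 / \<bar>t\<bar>) *\<^sub>R (F (x + t *\<^sub>R w) - (F x + t *\<^sub>R F' w))) \<longlongrightarrow> 0) (at_right 0)"
    by (simp add: has_vector_derivative_def has_derivative_within)
  have "((\<lambda>t. (1 / t) *\<^sub>R (F (x + t *\<^sub>R w) - F x) - F' w) \<longlongrightarrow> 0) (at_right 0)"
    by (rule Lim_transform_eventually[OF *])
      (auto simp: eventually_at_filter algebra_simps)
  then show ?thesis by (rule LIM_zero_cancel)
qed

section \<open>The lower-level solution and the hypergradient\<close>

lemma grad_xy_eq:
  fixes h :: "(real^'dx) \<times> (real^'dy) \<Rightarrow> real"
  assumes "h differentiable (at p)"
  shows grad_x_eq: "grad_x h p = fst (grad h p)" and grad_y_eq: "grad_y h p = snd (grad h p)"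
proof -
  obtain x y where p: "p = (x, y)" by fastforce
  have h: "(h has_derivative (\<lambda>v. v \<bullet> grad h (x, y))) (at (x, y))"
    using assms has_derivative_grad p by blast
  have "((\<lambda>u. h (u, y)) has_derivative (\<lambda>u. (u, 0) \<bullet> grad h (x, y))) (at x)"
    by (rule has_derivative_compose[of "\<lambda>u. (u, y)" "\<lambda>u. (u, 0)" x UNIV h, OF _ h])
      (auto intro!: derivative_eq_intros)
  then show "grad_x h p = fst (grad h p)"
    unfolding p grad_x_def by (auto simp: inner_prod_def intro!: grad_eqI)
  have "((\<lambda>v. h (x, v)) has_derivative (\<lambda>v. (0, v) \<bullet> grad h (x, y))) (at y)"
    by (rule has_derivative_compose[of "\<lambda>v. (x, v)" "\<lambda>v. (0, v)" y UNIV h, OF _ h])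
      (auto intro!: derivative_eq_intros)
  then show "grad_y h p = snd (grad h p)"
    unfolding p grad_y_def by (auto simp: inner_prod_def intro!: grad_eqI)
qed

lemma matrix_lipschitzD:
  fixes A :: "'a::metric_space \<Rightarrow> real^'n^'m"
  assumes "matrix_lipschitz M A"
  shows "norm ((A p - A q) *v w) \<le> M * dist p q * norm w"
proof -
  have "norm ((A p - A q) *v w) \<le> onorm ((*v) (A p - A q)) * norm w"
    by (rule onorm) (rule matrix_vector_mul_bounded_linear)
  also have "\<dots> \<le> (M * dist p q) * norm w"
    using assms by (intro mult_right_mono) (auto simp: matrix_lipschitz_def)
  finally show ?thesis .
qed

lemma matrix_inv_cancel:
  fixes A :: "real^'n^'n"
  assumes "invertible A"
  shows matrix_inv_left_cancel: "matrix_inv A *v (A *v w) = w"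
    and matrix_inv_right_cancel: "A *v (matrix_inv A *v w) = w"
proof -
  have "A ** matrix_inv A = mat 1 \<and> matrix_inv A ** A = mat 1"
    using assms unfolding invertible_def matrix_inv_def by (rule someI_ex)
  then show "matrix_inv A *v (A *v w) = w" "A *v (matrix_inv A *v w) = w"
    by (metis matrix_vector_mul_assoc matrix_vector_mul_lid)+
qed

text \<open>Under the other sign conditions, \<open>0 < Lf + Mg * B\<close> is equivalent to
  positivity of \<open>L_const\<close>, so that the step \<open>1 / L\<close> is meaningful;
  \<open>0 < Lg'\<close> makes \<open>Ly_const\<close> positive, by which arguments of logarithms
  are divided.\<close>

locale bilevel =
  fixes f g :: "(real^'dx) \<times> (real^'dy) \<Rightarrow> real"
    and Lf B Lg Lg' Mg \<mu>g :: real
  assumes constants: "0 \<le> Lf" "0 \<le> B" "0 \<le> Mg" "0 < \<mu>g" "0 < Lg'" "0 < Lf + Mg * B"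
    and f_differentiable: "\<And>p. f differentiable (at p)"
    and g_twice_differentiable: "twice_differentiable g"
    and g_smooth: "\<And>x. smooth_fun Lg (\<lambda>y. g (x, y))"
    and g_strongly_convex: "\<And>x. strongly_convex \<mu>g (\<lambda>y. g (x, y))"
    and grad_f_lipschitz: "Lf-lipschitz_on UNIV (grad f)"
    and grad_y_f_bound: "\<And>p. norm (grad_y f p) \<le> B"
    and hess_xy_lipschitz: "matrix_lipschitz Mg (hess_xy g)"
    and hess_yy_lipschitz: "matrix_lipschitz Mg (hess_yy g)"
    and grad_y_g_lipschitz_x:
      "\<And>x x' y. norm (grad_y g (x, y) - grad_y g (x', y)) \<le> Lg' * norm (x - x')"
begin

section \<open>Derivative blocks of the lower-level objective\<close>

lemma grad_slice: "grad (\<lambda>v. g (x, v)) = (\<lambda>y. grad_y g (x, y))"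
  by (simp add: grad_y_def fun_eq_iff)

lemma slice_differentiable: "(\<lambda>v. g (x, v)) differentiable (at y)"
  using g_smooth by (simp add: smooth_fun_def)

lemma grad_y_g_monotone:
  "\<mu>g * (norm (a - b))\<^sup>2 \<le> (grad_y g (x, a) - grad_y g (x, b)) \<bullet> (a - b)"
  using strongly_convex_grad_monotone[OF slice_differentiable g_strongly_convex, of a b x]
  by (simp add: grad_slice)

lemma grad_y_g_lipschitz_y: "norm (grad_y g (x, a) - grad_y g (x, b)) \<le> Lg * norm (a - b)"
  using g_smooth[of x] lipschitz_onD[of Lg UNIV "\<lambda>y. grad_y g (x, y)" a b]
  by (simp add: smooth_fun_def grad_slice dist_norm)

text \<open>A unit vector exists because index types are nonempty; strong convexity and smoothness
  are compared along it.\<close>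

lemma \<mu>g_le_Lg: "\<mu>g \<le> Lg"
proof -
  define w :: "real^'dy" where "w = axis undefined 1"
  have w: "norm w = 1" by (simp add: w_def)
  define d where "d = grad_y g (0, w) - grad_y g (0, 0)"
  have "\<mu>g \<le> d \<bullet> w" using grad_y_g_monotone[of w 0 0] w by (simp add: d_def)
  also have "\<dots> \<le> norm d" using norm_cauchy_schwarz[of d w] w by simp
  also have "\<dots> \<le> Lg" using grad_y_g_lipschitz_y[of 0 w 0] w by (simp add: d_def)
  finally show ?thesis .
qed

lemma Lg_pos: "0 < Lg"
  using \<mu>g_le_Lg constants(4) by linarith

lemma grad_y_g_cocoercive:
  "(norm (grad_y g (x, a) - grad_y g (x, b)))\<^sup>2
    \<le> Lg * ((grad_y g (x, a) - grad_y g (x, b)) \<bullet> (a - b))"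
  using smooth_convex_grad_cocoercive[OF Lg_pos g_smooth, of x a b]
    strongly_convex_mono[OF g_strongly_convex, of 0 x] constants
  by (simp add: grad_slice)

text \<open>All three come from the total derivative \<open>D\<close> of \<open>grad g\<close>:
  restriction to a coordinate subspace gives a partial Jacobian, and linearity reassembles the joint
  form, which implicit differentiation of \<open>y_star\<close> needs.\<close>

lemma hess_yy_derivative: "((\<lambda>v. grad_y g (x, v)) has_derivative (*v) (hess_yy g (x, y))) (at y)"
  and hess_xy_derivative:
    "((\<lambda>u. grad_y g (u, y)) has_derivative (*v) (transpose (hess_xy g (x, y)))) (at x)"
  and grad_y_g_derivative:
    "(grad_y g has_derivative (\<lambda>q. transpose (hess_xy g (x, y)) *v fst q + hess_yy g (x, y) *v snd q))
      (at (x, y))"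
proof -
  have eq: "grad_y g = (\<lambda>p. snd (grad g p))"
    using g_twice_differentiable unfolding twice_differentiable_def by (intro ext grad_y_eq) blast
  obtain D where "(grad g has_derivative D) (at (x, y))"
    using g_twice_differentiable unfolding twice_differentiable_def differentiable_def by blast
  then have D: "(grad_y g has_derivative (\<lambda>q. snd (D q))) (at (x, y))"
    unfolding eq by (auto intro!: derivative_eq_intros)
  have y: "((\<lambda>v. grad_y g (x, v)) has_derivative (\<lambda>v. snd (D (0, v)))) (at y)"
    by (rule has_derivative_compose[of "\<lambda>v. (x, v)" "\<lambda>v. (0, v)" y UNIV "grad_y g", OF _ D])
      (auto intro!: derivative_eq_intros)
  then show dy: "((\<lambda>v. grad_y g (x, v)) has_derivative (*v) (hess_yy g (x, y))) (at y)"
    by (auto simp: hess_yy_def jacobian_works[symmetric] differentiable_def)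
  have x: "((\<lambda>u. grad_y g (u, y)) has_derivative (\<lambda>u. snd (D (u, 0)))) (at x)"
    by (rule has_derivative_compose[of "\<lambda>u. (u, y)" "\<lambda>u. (u, 0)" x UNIV "grad_y g", OF _ D])
      (auto intro!: derivative_eq_intros)
  then show dx: "((\<lambda>u. grad_y g (u, y)) has_derivative (*v) (transpose (hess_xy g (x, y)))) (at x)"
    by (auto simp: hess_xy_def jacobian_works[symmetric] differentiable_def)
  have "snd (D q) = transpose (hess_xy g (x, y)) *v fst q + hess_yy g (x, y) *v snd q" for q
  proof -
    have "linear (\<lambda>q. snd (D q))" using D has_derivative_linear by blast
    from linear_add[OF this, of "(fst q, 0)" "(0, snd q)"]
    have "snd (D q) = snd (D (fst q, 0)) + snd (D (0, snd q))" by simp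
    moreover have "snd (D (fst q, 0)) = transpose (hess_xy g (x, y)) *v fst q"
      using has_derivative_unique[OF x dx] by metis
    moreover have "snd (D (0, snd q)) = hess_yy g (x, y) *v snd q"
      using has_derivative_unique[OF y dy] by metis
    ultimately show ?thesis by simp
  qed
  then show "(grad_y g has_derivative (\<lambda>q. transpose (hess_xy g (x, y)) *v fst q + hess_yy g (x, y) *v snd q))
      (at (x, y))"
    using D by presburger
qed

text \<open>The difference quotients \<open>q t\<close> satisfy both inequalities, by monotonicity
  and cocoercivity of the gradient slices, and these survive the limit.\<close>

lemma hess_yy_lower: "\<mu>g * (norm w)\<^sup>2 \<le> (hess_yy g p *v w) \<bullet> w"
  and hess_yy_cocoercive: "(norm (hess_yy g p *v w))\<^sup>2 \<le> Lg * ((hess_yy g p *v w) \<bullet> w)"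
proof -
  obtain x y where p: "p = (x, y)" by fastforce
  define q where "q t = (1 / t) *\<^sub>R (grad_y g (x, y + t *\<^sub>R w) - grad_y g (x, y))" for t
  have lim: "(q \<longlongrightarrow> hess_yy g p *v w) (at_right 0)"
    using has_derivative_imp_directional_limit[OF hess_yy_derivative] unfolding q_def p .
  have *: "\<mu>g * (norm w)\<^sup>2 \<le> q t \<bullet> w \<and> (norm (q t))\<^sup>2 \<le> Lg * (q t \<bullet> w)" if "0 < t" for t
  proof -
    define d where "d = grad_y g (x, y + t *\<^sub>R w) - grad_y g (x, y)"
    have "\<mu>g * (t\<^sup>2 * (norm w)\<^sup>2) \<le> t * (d \<bullet> w)"
      using grad_y_g_monotone[of "y + t *\<^sub>R w" y x] that by (simp add: d_def power_mult_distrib)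
    then have "t * (t * (\<mu>g * (norm w)\<^sup>2)) \<le> t * (d \<bullet> w)"
      by (simp add: power2_eq_square mult_ac)
    then have 1: "t * (\<mu>g * (norm w)\<^sup>2) \<le> d \<bullet> w" using that by simp
    have "(norm d)\<^sup>2 \<le> Lg * (t * (d \<bullet> w))"
      using grad_y_g_cocoercive[of x "y + t *\<^sub>R w" y] by (simp add: d_def)
    then have 2: "(norm d / t)\<^sup>2 \<le> Lg * ((d \<bullet> w) / t)"
      using that by (simp add: power_divide divide_le_eq power2_eq_square mult_ac)
    have "q t \<bullet> w = (d \<bullet> w) / t" "norm (q t) = norm d / t" using that by (auto simp: q_def d_def)
    moreover have "\<mu>g * (norm w)\<^sup>2 \<le> (d \<bullet> w) / t" using 1 that by (simp add: field_simps)
    ultimately show ?thesis using 2 by simp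
  qed
  have ev: "\<forall>\<^sub>F t in at_right 0. \<mu>g * (norm w)\<^sup>2 \<le> q t \<bullet> w"
    "\<forall>\<^sub>F t in at_right 0. (norm (q t))\<^sup>2 \<le> Lg * (q t \<bullet> w)"
    using * eventually_at_right_less[of "0::real"] by (auto elim: eventually_mono)
  show "\<mu>g * (norm w)\<^sup>2 \<le> (hess_yy g p *v w) \<bullet> w"
    by (rule tendsto_le[OF _ _ _ ev(1)]) (auto intro!: tendsto_intros lim)
  show "(norm (hess_yy g p *v w))\<^sup>2 \<le> Lg * ((hess_yy g p *v w) \<bullet> w)"
    by (rule tendsto_le[OF _ _ _ ev(2)]) (auto intro!: tendsto_intros lim)
qed

text \<open>Symmetry passes to the inverse and later turns the chain rule through
  \<open>y_star\<close> into its adjoint form with \<open>z_star\<close>.\<close>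

lemma hess_yy_symmetric: "(hess_yy g p *v v) \<bullet> u = v \<bullet> (hess_yy g p *v u)"
proof -
  obtain x y where p: "p = (x, y)" by fastforce
  have "(grad (\<lambda>v. g (x, v)) has_derivative (*v) (hess_yy g p)) (at y)"
    using hess_yy_derivative by (simp add: grad_slice p)
  from hessian_symmetric[OF slice_differentiable this, of v u] show ?thesis
    by (simp add: inner_commute)
qed

lemma hess_yy_norm_lower: "\<mu>g * norm w \<le> norm (hess_yy g p *v w)"
proof (cases "w = 0")
  case False
  have "\<mu>g * norm w * norm w \<le> norm (hess_yy g p *v w) * norm w"
    using hess_yy_lower[of w p] norm_cauchy_schwarz[of "hess_yy g p *v w" w]
    by (simp add: power2_eq_square)
  then show ?thesis using False by simp
qed simp

lemma hess_yy_invertible: "invertible (hess_yy g p)"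
proof -
  have "w = 0" if "hess_yy g p *v w = 0" for w
    using hess_yy_norm_lower[of w p] that constants(4) by (simp add: mult_le_0_iff)
  then show ?thesis
    using invertible_left_inverse matrix_left_invertible_ker by blast
qed

lemmas hess_yy_inv_left = matrix_inv_left_cancel[OF hess_yy_invertible]
  and hess_yy_inv_right = matrix_inv_right_cancel[OF hess_yy_invertible]

lemma hess_yy_inv_bound: "norm (matrix_inv (hess_yy g p) *v w) \<le> norm w / \<mu>g"
  using hess_yy_norm_lower[of "matrix_inv (hess_yy g p) *v w" p] constants(4)
  by (simp add: hess_yy_inv_right field_simps)

lemma hess_yy_inv_symmetric:
  "(matrix_inv (hess_yy g p) *v v) \<bullet> u = v \<bullet> (matrix_inv (hess_yy g p) *v u)"
  by (metis hess_yy_inv_right hess_yy_symmetric)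

lemma hess_xy_transpose_bound: "norm (transpose (hess_xy g p) *v w) \<le> Lg' * norm w"
proof -
  obtain x y where p: "p = (x, y)" by fastforce
  define q where "q t = (1 / t) *\<^sub>R (grad_y g (x + t *\<^sub>R w, y) - grad_y g (x, y))" for t
  have lim: "(q \<longlongrightarrow> transpose (hess_xy g p) *v w) (at_right 0)"
    using has_derivative_imp_directional_limit[OF hess_xy_derivative] unfolding q_def p .
  have "norm (q t) \<le> Lg' * norm w" if "0 < t" for t
    using grad_y_g_lipschitz_x[of "x + t *\<^sub>R w" y x] that
    by (simp add: q_def divide_le_eq mult_ac del: scaleR_right_diff_distrib)
  then have ev: "\<forall>\<^sub>F t in at_right 0. norm (q t) \<le> Lg' * norm w"
    using eventually_at_right_less[of "0::real"] by (auto elim: eventually_mono)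
  show ?thesis
    by (rule tendsto_le[OF _ tendsto_const tendsto_norm[OF lim] ev]) simp
qed

text \<open>Duality: the Lipschitz condition in \<open>x\<close> bounds the transpose, and testing
  the image of \<open>w\<close> against itself moves the bound to the matrix.\<close>

lemma hess_xy_bound: "norm (hess_xy g p *v w) \<le> Lg' * norm w"
proof (cases "hess_xy g p *v w = 0")
  case True
  then show ?thesis using constants by simp
next
  case False
  define v where "v = hess_xy g p *v w"
  have "norm v * norm v = v \<bullet> (hess_xy g p *v w)"
    by (simp add: v_def power2_norm_eq_inner[symmetric] power2_eq_square)
  also have "\<dots> = (transpose (hess_xy g p) *v v) \<bullet> w"
    by (metis dot_lmul_matrix vector_transpose_matrix transpose_matrix_vector)
  also have "\<dots> \<le> norm (transpose (hess_xy g p) *v v) * norm w" by (rule norm_cauchy_schwarz)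
  also have "\<dots> \<le> Lg' * norm v * norm w"
    by (intro mult_right_mono hess_xy_transpose_bound) simp
  finally have "norm v * norm v \<le> (Lg' * norm w) * norm v" by (simp add: mult_ac)
  then show ?thesis using False by (simp add: v_def)
qed

lemma grad_xy_f_lipschitz:
  "norm (grad_x f p - grad_x f q) \<le> Lf * dist p q" "norm (grad_y f p - grad_y f q) \<le> Lf * dist p q"
proof -
  have "norm (grad f p - grad f q) \<le> Lf * dist p q"
    using lipschitz_onD[OF grad_f_lipschitz] by (simp add: dist_norm)
  moreover have "norm (fst (grad f p - grad f q)) \<le> norm (grad f p - grad f q)"
    "norm (snd (grad f p - grad f q)) \<le> norm (grad f p - grad f q)"
    by (metis norm_fst_le norm_snd_le prod.collapse)+
  ultimately show "norm (grad_x f p - grad_x f q) \<le> Lf * dist p q"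
    "norm (grad_y f p - grad_y f q) \<le> Lf * dist p q"
    using grad_x_eq[OF f_differentiable] grad_y_eq[OF f_differentiable] by auto
qed

section \<open>Lipschitz continuity and differentiation of the lower-level solutions\<close>

abbreviation "L\<^sub>y \<equiv> Ly_const Lg' \<mu>g"
abbreviation "L\<^sub>z \<equiv> Lz_const Lf B Mg \<mu>g"
abbreviation "L\<^sub>\<psi> \<equiv> Lpsi_const Lf B Lg' Mg \<mu>g"
abbreviation "L \<equiv> L_const Lf B Lg' Mg \<mu>g"

lemma hess_yy_z_star: "hess_yy g p *v z_star f g p = - grad_y f p"
  by (simp add: z_star_def vec.neg hess_yy_inv_right)

lemma z_star_bound: "norm (z_star f g p) \<le> B / \<mu>g"
proof -
  have "norm (z_star f g p) \<le> norm (grad_y f p) / \<mu>g"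
    using hess_yy_inv_bound by (simp add: z_star_def)
  also have "\<dots> \<le> B / \<mu>g" using grad_y_f_bound constants by (simp add: divide_right_mono)
  finally show ?thesis .
qed

lemma z_star_lipschitz: "norm (z_star f g p - z_star f g q) \<le> L\<^sub>z * dist p q"
proof -
  let ?H = "\<lambda>p. hess_yy g p" and ?z = "z_star f g"
  \<comment> \<open>Residual of subtracting the two linear systems. Only the Hessian at
    \<open>p\<close> gets inverted, so the difference of Hessians acts on
    \<open>z_star f g q\<close>, which is bounded by \<open>B / \<mu>g\<close>.\<close>
  define r where "r = grad_y f q - grad_y f p - (?H p - ?H q) *v ?z q"
  have "?H p *v (?z p - ?z q) = r"
    by (simp add: r_def matrix_vector_mult_diff_distrib matrix_vector_mult_diff_rdistrib
        hess_yy_z_star)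
  then have "norm (?z p - ?z q) \<le> norm r / \<mu>g"
    using hess_yy_inv_bound[of p r] hess_yy_inv_left[of p "?z p - ?z q"] by simp
  also have "norm r \<le> Lf * dist p q + Mg * dist p q * (B / \<mu>g)"
  proof -
    have "norm r \<le> norm (grad_y f q - grad_y f p) + norm ((?H p - ?H q) *v ?z q)"
      unfolding r_def by (rule norm_triangle_ineq4)
    moreover have "norm ((?H p - ?H q) *v ?z q) \<le> Mg * dist p q * norm (?z q)"
      by (rule matrix_lipschitzD[OF hess_yy_lipschitz])
    moreover have "Mg * dist p q * norm (?z q) \<le> Mg * dist p q * (B / \<mu>g)"
      using z_star_bound constants by (intro mult_left_mono) auto
    ultimately show ?thesis
      using grad_xy_f_lipschitz(2)[of q p] by (simp add: dist_commute)
  qed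
  finally show ?thesis
    using constants(4) by (simp add: Lz_const_def divide_right_mono field_simps power2_eq_square)
qed

text \<open>A zero of the gradient is a fixed point of a contractive gradient step.\<close>
lemma grad_y_g_y_star: "grad_y g (x, y_star g x) = 0"
proof -
  define c where "c = 1 - \<mu>g / Lg"
  have c: "0 \<le> c" "c < 1" using \<mu>g_le_Lg Lg_pos constants(4) by (auto simp: c_def)
  define F where "F y = y - (1 / Lg) *\<^sub>R grad_y g (x, y)" for y
  have "dist (F a) (F b) \<le> sqrt c * dist a b" for a b
  proof -
    define w where "w = a - b"
    define d where "d = grad_y g (x, a) - grad_y g (x, b)"
    have "(norm (w - (1 / Lg) *\<^sub>R d))\<^sup>2 \<le> (1 - (2 - 1 / Lg * Lg) * (1 / Lg) * \<mu>g) * (norm w)\<^sup>2"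
      using Lg_pos grad_y_g_monotone grad_y_g_cocoercive
      unfolding w_def d_def by (intro norm_step_contraction) auto
    also have "\<dots> = c * (norm w)\<^sup>2" using Lg_pos by (simp add: c_def)
    finally have "norm (w - (1 / Lg) *\<^sub>R d) \<le> sqrt (c * (norm w)\<^sup>2)" by (rule real_le_rsqrt)
    moreover have "F a - F b = w - (1 / Lg) *\<^sub>R d"
      by (simp add: F_def w_def d_def algebra_simps)
    ultimately show ?thesis by (simp add: dist_norm w_def real_sqrt_mult)
  qed
  then have "\<exists>!y. F y = y"
    using c by (intro banach_fix_type[of "sqrt c"]) (auto simp: real_sqrt_lt_1_iff)
  then obtain y where "F y = y" by auto
  then have "grad_y g (x, y) = 0" using Lg_pos by (simp add: F_def)
  then have min: "g (x, y) \<le> g (x, v)" for v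
    using strongly_convex_lower_bound[OF slice_differentiable g_strongly_convex, of x y v]
      constants(4)
    by (simp add: grad_slice) (smt (verit) divide_nonneg_nonneg mult_nonneg_nonneg zero_le_power2)
  \<comment> \<open>\<open>arg_min_equality\<close> compares values only. Hence stationarity is
    obtained at \<open>y_star g x\<close> itself by Fermat's rule, without identifying it with the
    fixed point \<open>y\<close>.\<close>
  then have ys: "g (x, y_star g x) \<le> g (x, v)" for v
    using arg_min_equality[of "\<lambda>y. y \<in> UNIV" y "\<lambda>y. g (x, y)"]
    by (simp add: y_star_def arg_min_on_def)
  have "((\<lambda>v. g (x, v)) has_derivative (\<lambda>v. v \<bullet> grad_y g (x, y_star g x))) (at (y_star g x))"
    using has_derivative_grad[OF slice_differentiable] by (simp add: grad_slice)
  then have "(\<lambda>v. v \<bullet> grad_y g (x, y_star g x)) = (\<lambda>v. 0)"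
    using ys by (intro differential_zero_maxmin[of _ UNIV "\<lambda>v. g (x, v)"]) auto
  then show ?thesis by (metis inner_eq_zero_iff)
qed

lemma y_star_lipschitz: "norm (y_star g x - y_star g x') \<le> L\<^sub>y * norm (x - x')"
proof (cases "y_star g x = y_star g x'")
  case True
  then show ?thesis using constants by (simp add: Ly_const_def)
next
  case False
  define w where "w = y_star g x - y_star g x'"
  \<comment> \<open>Both solutions are stationary, so \<open>d\<close> is at once a gradient
    difference in \<open>y\<close> at the fixed \<open>x\<close>, open to monotonicity, and one in
    \<open>x\<close> at the fixed \<open>y_star g x'\<close>, open to the Lipschitz bound.\<close>
  define d where "d = grad_y g (x', y_star g x') - grad_y g (x, y_star g x')"
  have "\<mu>g * norm w * norm w \<le> d \<bullet> w"
    using grad_y_g_monotone[of "y_star g x" "y_star g x'" x] grad_y_g_y_star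
    by (simp add: w_def d_def power2_eq_square)
  also have "\<dots> \<le> norm d * norm w" by (rule norm_cauchy_schwarz)
  also have "\<dots> \<le> (Lg' * norm (x - x')) * norm w"
    using grad_y_g_lipschitz_x[of x' "y_star g x'" x]
    by (intro mult_right_mono) (auto simp: d_def norm_minus_commute)
  finally have "\<mu>g * norm w \<le> Lg' * norm (x - x')" using False by (simp add: w_def)
  then show ?thesis using constants(4) by (simp add: Ly_const_def w_def field_simps)
qed

text \<open>Implicit differentiation by hand: stationarity at \<open>x'\<close> is linearised at
  \<open>(x, y_star g x)\<close>. As \<open>y_star\<close> is already Lipschitz, the remainder is
  small relative to \<open>norm (x' - x)\<close>, and the inverse Hessian solves for the
  increment.\<close>

lemma y_star_derivative:
  "(y_star g has_derivative
     (\<lambda>h. - (matrix_inv (hess_yy g (x, y_star g x)) *v (transpose (hess_xy g (x, y_star g x)) *v h))))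
   (at x)"
proof -
  define y where "y = y_star g x"
  define J where "J = transpose (hess_xy g (x, y))"
  define H where "H = hess_yy g (x, y)"
  define K where "K = 1 + L\<^sub>y"
  have K: "0 < K" using constants by (simp add: K_def Ly_const_def add_pos_nonneg)
  have D: "(grad_y g has_derivative (\<lambda>q. J *v fst q + H *v snd q)) (at (x, y))"
    using grad_y_g_derivative by (simp add: J_def H_def)
  have "(y_star g has_derivative (\<lambda>h. - (matrix_inv H *v (J *v h)))) (at x)"
    unfolding has_derivative_at_alt
  proof (intro conjI allI impI)
    show "bounded_linear (\<lambda>h. - (matrix_inv H *v (J *v h)))"
      by (intro bounded_linear_minus bounded_linear_compose[OF matrix_vector_mul_bounded_linear]
          matrix_vector_mul_bounded_linear)
    fix e :: real assume "0 < e"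
    \<comment> \<open>\<open>K\<close> bounds the displacement in the product space relative to
      \<open>norm (x' - x)\<close>, and \<open>\<mu>g\<close> pays for the inverse Hessian; the
      final error is then exactly \<open>e\<close>.\<close>
    define e' where "e' = e * \<mu>g / K"
    have e': "0 < e'" using \<open>0 < e\<close> K constants(4) by (simp add: e'_def)
    obtain d where d: "0 < d"
      and bd: "\<And>q. norm (q - (x, y)) < d \<Longrightarrow>
        norm (grad_y g q - grad_y g (x, y) - (J *v fst (q - (x, y)) + H *v snd (q - (x, y))))
          \<le> e' * norm (q - (x, y))"
      using D e' unfolding has_derivative_at_alt by blast
    show "\<exists>d>0. \<forall>x'. norm (x' - x) < d \<longrightarrow>
      norm (y_star g x' - y_star g x - - (matrix_inv H *v (J *v (x' - x)))) \<le> e * norm (x' - x)"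
    proof (intro exI conjI allI impI)
      show "0 < d / K" using d K by simp
      fix x' assume x': "norm (x' - x) < d / K"
      define k where "k = y_star g x' - y"
      define q where "q = (x', y_star g x')"
      have "norm (q - (x, y)) \<le> norm (x' - x) + norm k"
        using norm_Pair_le[of "x' - x" k] by (simp add: q_def k_def)
      also have "\<dots> \<le> K * norm (x' - x)"
        using y_star_lipschitz[of x' x] by (simp add: k_def y_def K_def algebra_simps)
      finally have qn: "norm (q - (x, y)) \<le> K * norm (x' - x)" .
      also have "\<dots> < d" using x' K by (simp add: field_simps)
      finally have "norm (0 - (J *v (x' - x) + H *v k)) \<le> e' * norm (q - (x, y))"
        using bd[of q] grad_y_g_y_star by (simp add: q_def k_def y_def)
      then have "norm (J *v (x' - x) + H *v k) \<le> e' * norm (q - (x, y))"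
        by (metis diff_0 norm_minus_cancel)
      also have "\<dots> \<le> e' * (K * norm (x' - x))" using qn e' by (intro mult_left_mono) auto
      finally have r: "norm (J *v (x' - x) + H *v k) \<le> e' * (K * norm (x' - x))" .
      have "k + matrix_inv H *v (J *v (x' - x)) = matrix_inv H *v (J *v (x' - x) + H *v k)"
        by (simp add: H_def matrix_vector_right_distrib hess_yy_inv_left)
      then have "norm (k + matrix_inv H *v (J *v (x' - x))) \<le> norm (J *v (x' - x) + H *v k) / \<mu>g"
        using hess_yy_inv_bound by (simp add: H_def)
      also have "\<dots> \<le> e' * (K * norm (x' - x)) / \<mu>g"
        using r constants(4) by (simp add: divide_right_mono)
      also have "\<dots> = e * norm (x' - x)" using K constants(4) by (simp add: e'_def)
      finally show "norm (y_star g x' - y_star g x - - (matrix_inv H *v (J *v (x' - x)))) \<le> e * norm (x' - x)"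
        by (simp add: k_def y_def)
    qed
  qed
  then show ?thesis by (simp add: H_def J_def y_def)
qed

definition hypergrad :: "(real^'dx) \<times> (real^'dy) \<Rightarrow> real^'dx" where
  "hypergrad p = grad_x f p + hess_xy g p *v z_star f g p"

lemma outer_obj_derivative:
  "(outer_obj f g has_derivative (\<lambda>h. h \<bullet> hypergrad (x, y_star g x))) (at x)"
proof -
  define p where "p = (x, y_star g x)"
  define J where "J = transpose (hess_xy g p)"
  have "(outer_obj f g has_derivative
      (\<lambda>h. (h, - (matrix_inv (hess_yy g p) *v (J *v h))) \<bullet> grad f p)) (at x)"
    unfolding outer_obj_def
    by (rule has_derivative_compose[of "\<lambda>x. (x, y_star g x)" _ x UNIV f,
          OF _ has_derivative_grad[OF f_differentiable], folded p_def])
      (auto intro!: derivative_eq_intros y_star_derivative simp: J_def p_def)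
  moreover have "(h, - (matrix_inv (hess_yy g p) *v (J *v h))) \<bullet> grad f p = h \<bullet> hypergrad p" for h
  proof -
    have "(h, - (matrix_inv (hess_yy g p) *v (J *v h))) \<bullet> grad f p
        = h \<bullet> grad_x f p - (matrix_inv (hess_yy g p) *v (J *v h)) \<bullet> grad_y f p"
      by (simp add: inner_prod_def grad_x_eq[OF f_differentiable] grad_y_eq[OF f_differentiable])
    \<comment> \<open>Symmetry moves the inverse Hessian from \<open>J *v h\<close> to
      \<open>grad_y f p\<close>, which produces \<open>z_star\<close> together with its
      sign.\<close>
    also have "\<dots> = h \<bullet> grad_x f p + (J *v h) \<bullet> z_star f g p"
      by (simp add: hess_yy_inv_symmetric z_star_def)
    also have "(J *v h) \<bullet> z_star f g p = h \<bullet> (hess_xy g p *v z_star f g p)"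
      unfolding J_def
      by (metis dot_lmul_matrix vector_transpose_matrix transpose_matrix_vector)
    finally show ?thesis by (simp add: hypergrad_def inner_add_right)
  qed
  ultimately show ?thesis by (simp add: p_def)
qed

lemma grad_outer_obj: "grad (outer_obj f g) x = hypergrad (x, y_star g x)"
  by (rule grad_eqI[OF outer_obj_derivative])

text \<open>Serves twice: \<open>z = z_star f g p\<close> gives the Lipschitz constant of the
  hypergradient, and an iterate \<open>z\<close> gives the error of the search direction.\<close>

lemma hypergrad_estimate:
  "norm (grad_x f p + hess_xy g p *v z - hypergrad q)
    \<le> (Lf + Mg * B / \<mu>g + Lg' * L\<^sub>z) * dist p q + Lg' * norm (z - z_star f g p)"
proof -
  let ?z = "z_star f g" and ?J = "hess_xy g"
  \<comment> \<open>One ingredient changes at a time, so that a difference of matrices meets the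
    bounded vector \<open>z_star f g q\<close> and a difference of vectors meets the bounded matrix
    at \<open>p\<close>.\<close>
  define a b c d where "a = grad_x f p - grad_x f q" and "b = (?J p - ?J q) *v ?z q"
    and "c = ?J p *v (?z p - ?z q)" and "d = ?J p *v (z - ?z p)"
  have eq: "grad_x f p + ?J p *v z - hypergrad q = a + b + c + d"
    by (simp add: a_def b_def c_def d_def hypergrad_def matrix_vector_mult_diff_distrib
        matrix_vector_mult_diff_rdistrib)
  have "norm (a + b + c + d) \<le> norm a + norm b + norm c + norm d"
    by (intro norm_triangle_le add_mono order_refl)
  moreover have "norm a \<le> Lf * dist p q" unfolding a_def by (rule grad_xy_f_lipschitz)
  moreover have "norm b \<le> Mg * dist p q * norm (?z q)"
    unfolding b_def by (rule matrix_lipschitzD[OF hess_xy_lipschitz])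
  moreover have "Mg * dist p q * norm (?z q) \<le> Mg * dist p q * (B / \<mu>g)"
    using z_star_bound constants by (intro mult_left_mono) auto
  moreover have "norm c \<le> Lg' * norm (?z p - ?z q)" unfolding c_def by (rule hess_xy_bound)
  moreover have "Lg' * norm (?z p - ?z q) \<le> Lg' * (L\<^sub>z * dist p q)"
    using z_star_lipschitz constants by (intro mult_left_mono) auto
  moreover have "norm d \<le> Lg' * norm (z - ?z p)" unfolding d_def by (rule hess_xy_bound)
  moreover have "(Lf + Mg * B / \<mu>g + Lg' * L\<^sub>z) * dist p q
      = Lf * dist p q + Mg * dist p q * (B / \<mu>g) + Lg' * (L\<^sub>z * dist p q)"
    by (simp add: distrib_right)
  ultimately show ?thesis unfolding eq by linarith
qed

text \<open>\<open>L\<close> has two factors because the gradient is a composition: the first is the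
  Lipschitz constant of the hypergradient, the second, \<open>1 + L\<^sub>y\<close>, that of
  \<open>x \<mapsto> (x, y_star g x)\<close>.\<close>

lemma smooth_outer_obj: "smooth_fun L (outer_obj f g)"
proof -
  have "norm (hypergrad (x, y_star g x) - hypergrad (x', y_star g x')) \<le> L * norm (x - x')" for x x'
  proof -
    let ?p = "(x, y_star g x)" and ?q = "(x', y_star g x')"
    have "dist ?p ?q \<le> norm (x - x') + norm (y_star g x - y_star g x')"
      using norm_Pair_le[of "x - x'" "y_star g x - y_star g x'"] by (simp add: dist_norm)
    also have "\<dots> \<le> (1 + Lg' / \<mu>g) * norm (x - x')"
      using y_star_lipschitz[of x x'] by (simp add: Ly_const_def algebra_simps)
    finally have d: "dist ?p ?q \<le> (1 + Lg' / \<mu>g) * norm (x - x')" .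
    have "norm (hypergrad ?p - hypergrad ?q) \<le> (Lf + Mg * B / \<mu>g + Lg' * L\<^sub>z) * dist ?p ?q"
      using hypergrad_estimate[of ?p "z_star f g ?p" ?q] by (simp add: hypergrad_def)
    also have "\<dots> \<le> (Lf + Mg * B / \<mu>g + Lg' * L\<^sub>z) * ((1 + Lg' / \<mu>g) * norm (x - x'))"
      using constants d by (intro mult_left_mono) (auto simp: Lz_const_def)
    also have "\<dots> = L * norm (x - x')"
      by (simp add: L_const_def Lz_const_def add_divide_distrib algebra_simps)
    finally show ?thesis .
  qed
  moreover have "0 \<le> L" using constants by (simp add: L_const_def)
  ultimately show ?thesis
    using outer_obj_derivative
    by (auto simp: smooth_fun_def differentiable_def grad_outer_obj dist_norm intro!: lipschitz_onI)
qed

end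

section \<open>Convergence of the outer iteration\<close>

lemma one_minus_power_le_exp:
  fixes q :: real
  assumes "0 \<le> q" "q \<le> 1" "c \<le> q * real n"
  shows "(1 - q) ^ n \<le> exp (- c)"
proof -
  have "(1 - q) ^ n \<le> exp (- q) ^ n"
    using assms exp_ge_add_one_self[of "- q"] by (intro power_mono) auto
  also have "\<dots> = exp (- (q * real n))"
    by (simp add: exp_of_nat_mult[symmetric] mult.commute)
  also have "\<dots> \<le> exp (- c)" using assms by simp
  finally show ?thesis .
qed

lemma norm_add_squared_le:
  fixes a b :: "'a::real_inner"
  shows "(norm (a + b))\<^sup>2 \<le> 2 * (norm a)\<^sup>2 + 2 * (norm b)\<^sup>2"
proof -
  have "0 \<le> (norm (a - b))\<^sup>2" by simp
  then show ?thesis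
    unfolding power2_norm_eq_inner
    by (simp add: inner_add_left inner_add_right inner_diff_left inner_diff_right inner_commute)
qed

lemma add_squared_le:
  fixes a b :: real
  shows "(a + b)\<^sup>2 \<le> 2 * a\<^sup>2 + 2 * b\<^sup>2"
  using norm_add_squared_le[of a b] by simp

text \<open>In the application \<open>P = L\<^sub>\<psi>\<^sup>2\<close>, \<open>Y = L\<^sub>y\<^sup>2\<close>, \<open>Z = L\<^sub>z\<^sup>2\<close>, the contraction factors of the inner
  loops are \<open>\<Lambda>\<close> and \<open>\<Theta>\<close>, \<open>d\<close> is the squared length of an outer step, and \<open>e\<close> is the squared error
  of the hypergradient.\<close>
lemma coupled_error_recursion:
  fixes V n d e u v :: "nat \<Rightarrow> real"
  assumes nonneg: "0 \<le> Y" "0 \<le> Z" "0 \<le> P" "0 \<le> \<Lambda>" "0 \<le> \<Theta>" "0 < L"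
      "\<And>k. 0 \<le> n k" "\<And>k. 0 \<le> d k" "\<And>k. 0 \<le> u k" "\<And>k. 0 \<le> v k"
    and descent: "\<And>k. V (Suc k) \<le> V k - n k / (2 * L) + e k / (2 * L)"
    and error: "\<And>k. e k \<le> 2 * P * (\<Lambda> * u k + \<Theta> * v k)"
    and step: "\<And>k. L\<^sup>2 * d k \<le> 2 * (n k + e k)"
    and u: "\<And>k. u (Suc k) \<le> 2 * \<Lambda> * u k + 2 * Y * d k"
    and v: "\<And>k. v (Suc k) \<le> 2 * \<Theta> * v k + 2 * Z * (d k + 4 * u (Suc k))"
    and small: "\<Lambda> \<le> 1 / 4" "\<Theta> \<le> 1 / 4" "P * \<Lambda> \<le> L / 64" "P * \<Lambda> * Y \<le> L\<^sup>2 / 1024"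
      "P * \<Theta> \<le> L / 64" "P * \<Theta> * Z \<le> L / 768" "P * \<Theta> * (Z * (1 + 16 * Y)) \<le> L\<^sup>2 / 1024"
    and lower: "\<And>k. Vmin \<le> V k"
  shows "(\<Sum>i<m. n i) \<le> 4 * L * (V 0 - Vmin + u 0 + v 0)"
proof -
  define SN SD SE SU SV where "SN = (\<Sum>i<m. n i)" and "SD = (\<Sum>i<m. d i)"
    and "SE = (\<Sum>i<m. e i)" and "SU = (\<Sum>i<m. u i)" and "SV = (\<Sum>i<m. v i)"
  define SU' where "SU' = (\<Sum>i<m. u (Suc i))"
  have S0: "0 \<le> SN" "0 \<le> SD" "0 \<le> SU" "0 \<le> SV"
    unfolding SN_def SD_def SU_def SV_def by (auto intro!: sum_nonneg nonneg)
  have shift: "(\<Sum>i<m. w i) \<le> w 0 + (\<Sum>i<m. w (Suc i))" if "\<And>k. 0 \<le> w k" for w :: "nat \<Rightarrow> real"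
    using sum.lessThan_Suc_shift[of w m] that[of m] by simp
  have "2 * L * (V m - V 0) \<le> SE - SN"
  proof -
    have "2 * L * (V (Suc i) - V i) \<le> e i - n i" for i
      using descent[of i] nonneg(6) by (simp add: field_simps)
    then have "(\<Sum>i<m. 2 * L * (V (Suc i) - V i)) \<le> (\<Sum>i<m. e i - n i)" by (rule sum_mono)
    moreover have "(\<Sum>i<m. 2 * L * (V (Suc i) - V i)) = 2 * L * (V m - V 0)"
      by (simp only: sum_distrib_left[symmetric] sum_lessThan_telescope)
    ultimately show ?thesis by (simp add: SE_def SN_def sum_subtractf)
  qed
  moreover have "L * Vmin \<le> L * V m" using lower nonneg(6) by simp
  ultimately have N: "SN \<le> 2 * (L * (V 0 - Vmin)) + SE" by (simp add: algebra_simps)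
  have E: "SE \<le> 2 * P * (\<Lambda> * SU + \<Theta> * SV)"
  proof -
    have "SE \<le> (\<Sum>i<m. 2 * P * (\<Lambda> * u i + \<Theta> * v i))" unfolding SE_def by (rule sum_mono) (rule error)
    then show ?thesis by (simp add: SU_def SV_def sum.distrib flip: sum_distrib_left)
  qed
  have D: "L\<^sup>2 * SD \<le> 2 * (SN + SE)"
  proof -
    have "(\<Sum>i<m. L\<^sup>2 * d i) \<le> (\<Sum>i<m. 2 * (n i + e i))" by (rule sum_mono) (rule step)
    then show ?thesis by (simp add: SD_def SN_def SE_def sum.distrib sum_distrib_left[symmetric])
  qed
  have "SU' \<le> (\<Sum>i<m. 2 * \<Lambda> * u i + 2 * Y * d i)" unfolding SU'_def by (rule sum_mono) (rule u)
  then have "SU' \<le> 2 * (\<Lambda> * SU) + 2 * (Y * SD)"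
    by (simp add: SU_def SD_def sum.distrib sum_distrib_left mult.assoc)
  moreover have "\<Lambda> * SU \<le> 1 / 4 * SU" using small(1) S0 by (intro mult_right_mono)
  \<comment> \<open>At most half of \<open>SU\<close> is carried over, so that half can be absorbed
    on the left. The shifted sum \<open>SU'\<close> gets its own bound because the recursion for
    \<open>v\<close> refers to \<open>u (Suc k)\<close>.\<close>
  ultimately have U': "SU' \<le> SU / 2 + 2 * (Y * SD)" by linarith
  moreover have "SU \<le> u 0 + SU'" unfolding SU_def SU'_def by (rule shift) (rule nonneg)
  ultimately have U: "SU \<le> 2 * u 0 + 4 * (Y * SD)" and U'': "SU' \<le> u 0 + 4 * (Y * SD)"
    by linarith+
  have "(\<Sum>i<m. v (Suc i)) \<le> (\<Sum>i<m. 2 * \<Theta> * v i + 2 * Z * (d i + 4 * u (Suc i)))"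
    by (rule sum_mono) (rule v)
  also have "\<dots> = 2 * (\<Theta> * SV) + 2 * Z * (SD + 4 * SU')"
    by (simp add: SV_def SD_def SU'_def sum.distrib mult.assoc flip: sum_distrib_left)
  finally have "SV \<le> v 0 + 2 * (\<Theta> * SV) + 2 * Z * (SD + 4 * SU')"
    using shift[of v] nonneg(10) by (simp add: SV_def)
  moreover have "\<Theta> * SV \<le> 1 / 4 * SV" using small(2) S0 by (intro mult_right_mono)
  ultimately have "SV \<le> 2 * v 0 + 4 * (Z * (SD + 4 * SU'))" by linarith
  also have "Z * (SD + 4 * SU') \<le> Z * (SD + 4 * (u 0 + 4 * (Y * SD)))"
    using U'' nonneg(2) by (intro mult_left_mono) auto
  finally have V: "SV \<le> 2 * v 0 + 4 * (Z * (SD + 4 * (u 0 + 4 * (Y * SD))))" by simp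
  have "SE \<le> 2 * P * (\<Lambda> * (2 * u 0 + 4 * (Y * SD))
      + \<Theta> * (2 * v 0 + 4 * (Z * (SD + 4 * (u 0 + 4 * (Y * SD))))))"
    using E U V nonneg by (smt (verit) mult_left_mono mult_nonneg_nonneg)
  also have "\<dots> = 4 * (P * \<Lambda> * u 0) + 4 * (P * \<Theta> * v 0) + 32 * (P * \<Theta> * Z * u 0)
      + 8 * (P * \<Lambda> * Y * SD) + 8 * (P * \<Theta> * (Z * (1 + 16 * Y)) * SD)"
    by (simp add: algebra_simps)
  also have "\<dots> \<le> 4 * (L / 64 * u 0) + 4 * (L / 64 * v 0) + 32 * (L / 768 * u 0)
      + 8 * (L\<^sup>2 / 1024 * SD) + 8 * (L\<^sup>2 / 1024 * SD)"
    using small nonneg S0 by (intro add_mono mult_left_mono mult_right_mono) auto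
  \<comment> \<open>The coefficient 1/64 closes the loop: by \<open>D\<close> and \<open>N\<close>
    the last term is at most \<open>SE / 16\<close> plus \<open>L * (V 0 - Vmin) / 16\<close>, so
    \<open>SE\<close> is absorbed.\<close>
  finally have "SE \<le> 5 / 48 * (L * u 0) + 1 / 16 * (L * v 0) + 1 / 64 * (L\<^sup>2 * SD)"
    by (simp add: mult_ac)
  moreover have "0 \<le> L * u 0" "0 \<le> L * v 0" "0 \<le> L * (V 0 - Vmin)"
    using nonneg lower by (auto intro!: mult_nonneg_nonneg)
  moreover have "4 * L * (V 0 - Vmin + u 0 + v 0) = 4 * (L * (V 0 - Vmin)) + 4 * (L * u 0) + 4 * (L * v 0)"
    by (simp add: algebra_simps)
  ultimately show ?thesis using N D S0(1) unfolding SN_def[symmetric] by argo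
qed

section \<open>The iterates of AmIGO\<close>

context bilevel
begin

lemma inner_y_contraction:
  "(norm (inner_y g (1 / Lg) n x y - y_star g x))\<^sup>2 \<le> (1 - \<mu>g / Lg) ^ n * (norm (y - y_star g x))\<^sup>2"
proof (induction n)
  case 0
  then show ?case by (simp add: inner_y_def)
next
  case (Suc n)
  define y\<^sub>n where "y\<^sub>n = inner_y g (1 / Lg) n x y"
  define w where "w = y\<^sub>n - y_star g x"
  define d where "d = grad_y g (x, y\<^sub>n) - grad_y g (x, y_star g x)"
  have "inner_y g (1 / Lg) (Suc n) x y - y_star g x = w - (1 / Lg) *\<^sub>R d"
    by (simp add: inner_y_def y\<^sub>n_def w_def d_def grad_y_g_y_star)
  also have "(norm (w - (1 / Lg) *\<^sub>R d))\<^sup>2 \<le> (1 - (2 - 1 / Lg * Lg) * (1 / Lg) * \<mu>g) * (norm w)\<^sup>2"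
    using Lg_pos grad_y_g_monotone grad_y_g_cocoercive
    unfolding w_def d_def by (intro norm_step_contraction) auto
  also have "\<dots> = (1 - \<mu>g / Lg) * (norm w)\<^sup>2" using Lg_pos by simp
  also have "\<dots> \<le> (1 - \<mu>g / Lg) * ((1 - \<mu>g / Lg) ^ n * (norm (y - y_star g x))\<^sup>2)"
    using Suc \<mu>g_le_Lg Lg_pos by (intro mult_left_mono) (auto simp: w_def y\<^sub>n_def)
  finally show ?case by (simp add: mult_ac)
qed

text \<open>The iteration is affine with fixed point \<open>z_star f g p\<close>, so the error
  \<open>w\<close> is stepped by its Hessian image. With \<open>c = 1 / (2 * Lg)\<close> the rate
  \<open>(2 - c * Lg) * c * \<mu>g\<close> is three quarters of \<open>\<mu>g / Lg\<close>.\<close>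

lemma inner_z_contraction:
  "(norm (inner_z f g (1 / (2 * Lg)) n p z - z_star f g p))\<^sup>2
    \<le> (1 - 3 / 4 * (\<mu>g / Lg)) ^ n * (norm (z - z_star f g p))\<^sup>2"
proof (induction n)
  case 0
  then show ?case by (simp add: inner_z_def)
next
  case (Suc n)
  define c where "c = 1 / (2 * Lg)"
  define z\<^sub>n where "z\<^sub>n = inner_z f g c n p z"
  define w where "w = z\<^sub>n - z_star f g p"
  have "hess_yy g p *v w = hess_yy g p *v z\<^sub>n + grad_y f p"
    by (simp add: w_def matrix_vector_mult_diff_distrib hess_yy_z_star)
  then have "inner_z f g c (Suc n) p z - z_star f g p = w - c *\<^sub>R (hess_yy g p *v w)"
    by (simp add: inner_z_def z\<^sub>n_def w_def)
  also have "(norm (w - c *\<^sub>R (hess_yy g p *v w)))\<^sup>2 \<le> (1 - (2 - c * Lg) * c * \<mu>g) * (norm w)\<^sup>2"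
    using Lg_pos hess_yy_lower hess_yy_cocoercive by (intro norm_step_contraction) (auto simp: c_def)
  also have "\<dots> = (1 - 3 / 4 * (\<mu>g / Lg)) * (norm w)\<^sup>2" using Lg_pos by (simp add: c_def)
  also have "\<dots> \<le> (1 - 3 / 4 * (\<mu>g / Lg))
      * ((1 - 3 / 4 * (\<mu>g / Lg)) ^ n * (norm (z - z_star f g p))\<^sup>2)"
    using Suc \<mu>g_le_Lg Lg_pos by (intro mult_left_mono) (auto simp: w_def z\<^sub>n_def c_def field_simps)
  finally show ?case by (simp add: mult_ac c_def)
qed

lemma L_pos: "0 < L"
proof -
  have "0 < Lf + Lg' * Mg * B / \<mu>g\<^sup>2 + (Lg' * Lf + Mg * B) / \<mu>g"
  proof (cases "Lf = 0")
    case True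
    then show ?thesis using constants by (intro add_nonneg_pos add_nonneg_nonneg divide_pos_pos) auto
  next
    case False
    then show ?thesis using constants by (intro add_pos_nonneg) auto
  qed
  then show ?thesis using constants by (simp add: L_const_def add_pos_nonneg)
qed

lemma hypergrad_error:
  assumes y: "(norm (y - y_star g x))\<^sup>2 \<le> a" and z: "(norm (z - z_star f g (x, y)))\<^sup>2 \<le> b"
  shows "(norm (grad_x f (x, y) + hess_xy g (x, y) *v z - grad (outer_obj f g) x))\<^sup>2
    \<le> 2 * L\<^sub>\<psi>\<^sup>2 * (a + b)"
proof -
  let ?e = "norm (grad_x f (x, y) + hess_xy g (x, y) *v z - grad (outer_obj f g) x)"
  let ?a = "norm (y - y_star g x)" and ?b = "norm (z - z_star f g (x, y))"
  have psi: "Lf + Mg * B / \<mu>g + Lg' * L\<^sub>z \<le> L\<^sub>\<psi>" "Lg' \<le> L\<^sub>\<psi>" by (auto simp: Lpsi_const_def)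
  have "dist (x, y) (x, y_star g x) = ?a" by (simp add: dist_Pair_Pair dist_norm)
  then have "?e \<le> (Lf + Mg * B / \<mu>g + Lg' * L\<^sub>z) * ?a + Lg' * ?b"
    using hypergrad_estimate[of "(x, y)" z "(x, y_star g x)"] by (simp add: grad_outer_obj)
  also have "\<dots> \<le> L\<^sub>\<psi> * ?a + L\<^sub>\<psi> * ?b"
    using psi by (intro add_mono mult_right_mono) auto
  finally have "?e\<^sup>2 \<le> (L\<^sub>\<psi> * ?a + L\<^sub>\<psi> * ?b)\<^sup>2" by (intro power_mono) auto
  also have "\<dots> \<le> 2 * (L\<^sub>\<psi> * ?a)\<^sup>2 + 2 * (L\<^sub>\<psi> * ?b)\<^sup>2" by (rule add_squared_le)
  also have "\<dots> = 2 * L\<^sub>\<psi>\<^sup>2 * (?a\<^sup>2 + ?b\<^sup>2)" by (simp add: power_mult_distrib algebra_simps)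
  also have "\<dots> \<le> 2 * L\<^sub>\<psi>\<^sup>2 * (a + b)" using y z by (intro mult_left_mono add_mono) auto
  finally show ?thesis .
qed

text \<open>At step \<open>1 / L\<close> the linear and the quadratic term combine into a completed
  square, so the inexactness of \<open>\<psi>\<close> enters only through its squared distance to
  the gradient.\<close>

lemma outer_step_descent:
  fixes \<psi> :: "real^'dx"
  shows "outer_obj f g (x - (1 / L) *\<^sub>R \<psi>) \<le> outer_obj f g x
    - (norm (grad (outer_obj f g) x))\<^sup>2 / (2 * L) + (norm (\<psi> - grad (outer_obj f g) x))\<^sup>2 / (2 * L)"
proof -
  define G where "G = grad (outer_obj f g) x"
  have "outer_obj f g (x - (1 / L) *\<^sub>R \<psi>)
      \<le> outer_obj f g x + G \<bullet> (- ((1 / L) *\<^sub>R \<psi>)) + L / 2 * (norm ((1 / L) *\<^sub>R \<psi>))\<^sup>2"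
    using smooth_fun_upper_bound[OF smooth_outer_obj, of "x - (1 / L) *\<^sub>R \<psi>" x]
    by (simp add: G_def)
  also have "L / 2 * (norm ((1 / L) *\<^sub>R \<psi>))\<^sup>2 = (norm \<psi>)\<^sup>2 / (2 * L)"
    using L_pos by (simp add: power_divide power2_eq_square)
  also have "G \<bullet> (- ((1 / L) *\<^sub>R \<psi>)) = - (2 * (G \<bullet> \<psi>)) / (2 * L)" using L_pos by simp
  also have "outer_obj f g x + - (2 * (G \<bullet> \<psi>)) / (2 * L) + (norm \<psi>)\<^sup>2 / (2 * L)
      = outer_obj f g x + ((norm \<psi>)\<^sup>2 - 2 * (G \<bullet> \<psi>)) / (2 * L)"
    by (simp add: diff_divide_distrib)
  also have "(norm \<psi>)\<^sup>2 - 2 * (G \<bullet> \<psi>) = (norm (\<psi> - G))\<^sup>2 - (norm G)\<^sup>2"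
    unfolding power2_norm_eq_inner by (simp add: inner_diff_left inner_diff_right inner_commute)
  finally show ?thesis by (simp add: G_def diff_divide_distrib)
qed

lemma amigo_sum_grad_bound:
  assumes steps: "\<And>k. \<alpha> k = 1 / Lg" "\<And>k. \<beta> k = 1 / (2 * Lg)" "\<And>k. \<gamma> k = 1 / L"
    and \<Lambda>: "\<Lambda> = (1 - \<mu>g / Lg) ^ T" and \<Theta>: "\<Theta> = (1 - 3 / 4 * (\<mu>g / Lg)) ^ N"
    and small: "\<Lambda> \<le> 1 / 4" "\<Theta> \<le> 1 / 4" "L\<^sub>\<psi>\<^sup>2 * \<Lambda> \<le> L / 64" "L\<^sub>\<psi>\<^sup>2 * \<Lambda> * L\<^sub>y\<^sup>2 \<le> L\<^sup>2 / 1024"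
      "L\<^sub>\<psi>\<^sup>2 * \<Theta> \<le> L / 64" "L\<^sub>\<psi>\<^sup>2 * \<Theta> * L\<^sub>z\<^sup>2 \<le> L / 768"
      "L\<^sub>\<psi>\<^sup>2 * \<Theta> * (L\<^sub>z\<^sup>2 * (1 + 16 * L\<^sub>y\<^sup>2)) \<le> L\<^sup>2 / 1024"
    and lower: "\<And>x. Lstar \<le> outer_obj f g x"
  shows "(\<Sum>i<m. (norm (grad (outer_obj f g) (amigo_x f g \<alpha> \<beta> \<gamma> T N x0 y' z' i)))\<^sup>2)
    \<le> 4 * L * (outer_obj f g x0 - Lstar + init_err_y g x0 y' + init_err_z f g (\<alpha> 0) T x0 y' z')"
proof -
  define s where "s = amigo f g \<alpha> \<beta> \<gamma> T N x0 y' z'"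
  define X where "X k = fst (s k)" for k
  define yp where "yp k = fst (snd (s k))" for k
  define zp where "zp k = snd (snd (s k))" for k
  define y where "y k = inner_y g (1 / Lg) T (X k) (yp k)" for k
  define z where "z k = inner_z f g (1 / (2 * Lg)) N (X k, y k) (zp k)" for k
  define \<psi> where "\<psi> k = grad_x f (X k, y k) + hess_xy g (X k, y k) *v z k" for k
  have rec: "X (Suc k) = X k - (1 / L) *\<^sub>R \<psi> k" "yp (Suc k) = y k" "zp (Suc k) = z k" for k
    by (simp_all add: X_def yp_def zp_def s_def y_def z_def \<psi>_def Let_def case_prod_beta steps)
  have init: "X 0 = x0" "yp 0 = y'" "zp 0 = z'" by (simp_all add: X_def yp_def zp_def s_def)
  let ?F = "outer_obj f g"
  define n where "n k = (norm (grad ?F (X k)))\<^sup>2" for k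
  define d where "d k = (norm (X (Suc k) - X k))\<^sup>2" for k
  define e where "e k = (norm (\<psi> k - grad ?F (X k)))\<^sup>2" for k
  \<comment> \<open>\<open>u\<close> and \<open>v\<close> measure the warm starts before the inner
    loops run, \<open>v\<close> against the target at the already updated \<open>y k\<close>. So
    \<open>u 0\<close> and \<open>v 0\<close> are the initial errors, and the loops contribute the
    factors \<open>\<Lambda>\<close> and \<open>\<Theta>\<close>.\<close>
  define u where "u k = (norm (yp k - y_star g (X k)))\<^sup>2" for k
  define v where "v k = (norm (zp k - z_star f g (X k, y k)))\<^sup>2" for k
  have q: "0 \<le> \<mu>g / Lg" "\<mu>g / Lg \<le> 1" using \<mu>g_le_Lg Lg_pos constants(4) by auto
  have \<Lambda>0: "0 \<le> \<Lambda>" "\<Lambda> \<le> 1" and \<Theta>0: "0 \<le> \<Theta>" using q by (auto simp: \<Lambda> \<Theta> intro!: power_le_one)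
  have u0: "0 \<le> u k" for k by (simp add: u_def)
  have y_err: "(norm (y k - y_star g (X k)))\<^sup>2 \<le> \<Lambda> * u k" for k
    unfolding y_def u_def \<Lambda> by (rule inner_y_contraction)
  have z_err: "(norm (z k - z_star f g (X k, y k)))\<^sup>2 \<le> \<Theta> * v k" for k
    unfolding z_def v_def \<Theta> by (rule inner_z_contraction)
  have "(\<Sum>i<m. n i) \<le> 4 * L * (?F (X 0) - Lstar + u 0 + v 0)"
  proof (rule coupled_error_recursion[where Y = "L\<^sub>y\<^sup>2" and Z = "L\<^sub>z\<^sup>2" and P = "L\<^sub>\<psi>\<^sup>2" and \<Lambda> = \<Lambda>
        and \<Theta> = \<Theta> and d = d and e = e and V = "\<lambda>k. ?F (X k)"])
    fix k
    show "?F (X (Suc k)) \<le> ?F (X k) - n k / (2 * L) + e k / (2 * L)"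
      unfolding rec n_def e_def by (rule outer_step_descent)
    show "e k \<le> 2 * L\<^sub>\<psi>\<^sup>2 * (\<Lambda> * u k + \<Theta> * v k)"
      unfolding e_def \<psi>_def by (rule hypergrad_error[OF y_err z_err])
    have "L\<^sup>2 * d k = (norm (\<psi> k))\<^sup>2" using L_pos by (simp add: d_def rec power_divide)
    also have "\<dots> \<le> 2 * (norm (\<psi> k - grad ?F (X k)))\<^sup>2 + 2 * (norm (grad ?F (X k)))\<^sup>2"
      using norm_add_squared_le[of "\<psi> k - grad ?F (X k)" "grad ?F (X k)"] by simp
    finally show "L\<^sup>2 * d k \<le> 2 * (n k + e k)" by (simp add: n_def e_def)
    show u_step: "u (Suc k) \<le> 2 * \<Lambda> * u k + 2 * L\<^sub>y\<^sup>2 * d k"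
    proof -
      have "u (Suc k) \<le> 2 * (norm (y k - y_star g (X k)))\<^sup>2
          + 2 * (norm (y_star g (X k) - y_star g (X (Suc k))))\<^sup>2"
        using norm_add_squared_le[of "y k - y_star g (X k)" "y_star g (X k) - y_star g (X (Suc k))"]
        by (simp add: u_def rec(2))
      moreover have "(norm (y_star g (X k) - y_star g (X (Suc k))))\<^sup>2 \<le> (L\<^sub>y * norm (X (Suc k) - X k))\<^sup>2"
        using y_star_lipschitz[of "X (Suc k)" "X k"] by (intro power_mono) (auto simp: norm_minus_commute)
      ultimately show ?thesis using y_err[of k] by (simp add: d_def power_mult_distrib)
    qed
    show "v (Suc k) \<le> 2 * \<Theta> * v k + 2 * L\<^sub>z\<^sup>2 * (d k + 4 * u (Suc k))"
    proof -
      let ?p = "(X k, y k)" and ?q = "(X (Suc k), y (Suc k))"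
      \<comment> \<open>The target of \<open>z\<close> also drifts with \<open>y\<close>. Both
        points are compared with \<open>y_star g (X (Suc k))\<close>: \<open>y k\<close> is the warm
        start there, with squared error \<open>u (Suc k)\<close>, and \<open>y (Suc k)\<close> is no
        worse. Hence the factor 4.\<close>
      have "(norm (y (Suc k) - y k))\<^sup>2 \<le> 2 * (norm (y (Suc k) - y_star g (X (Suc k))))\<^sup>2
          + 2 * (norm (y_star g (X (Suc k)) - y k))\<^sup>2"
        using norm_add_squared_le[of "y (Suc k) - y_star g (X (Suc k))" "y_star g (X (Suc k)) - y k"]
        by simp
      also have "(norm (y_star g (X (Suc k)) - y k))\<^sup>2 = u (Suc k)"
        by (simp add: u_def rec norm_minus_commute)
      also have "(norm (y (Suc k) - y_star g (X (Suc k))))\<^sup>2 \<le> u (Suc k)"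
        using y_err[of "Suc k"] mult_right_mono[OF \<Lambda>0(2) u0[of "Suc k"]] by linarith
      finally have yy: "(norm (y (Suc k) - y k))\<^sup>2 \<le> 4 * u (Suc k)" by simp
      have "(dist ?q ?p)\<^sup>2 = d k + (norm (y (Suc k) - y k))\<^sup>2"
        by (simp add: d_def dist_norm norm_Pair)
      then have dist: "(dist ?q ?p)\<^sup>2 \<le> d k + 4 * u (Suc k)" using yy by simp
      have "v (Suc k) \<le> 2 * (norm (z k - z_star f g ?p))\<^sup>2 + 2 * (norm (z_star f g ?p - z_star f g ?q))\<^sup>2"
        using norm_add_squared_le[of "z k - z_star f g ?p" "z_star f g ?p - z_star f g ?q"]
        by (simp add: v_def rec(3))
      moreover have "(norm (z_star f g ?p - z_star f g ?q))\<^sup>2 \<le> (L\<^sub>z * dist ?q ?p)\<^sup>2"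
        using z_star_lipschitz[of ?p ?q] by (intro power_mono) (auto simp: dist_commute)
      moreover have "L\<^sub>z\<^sup>2 * (dist ?q ?p)\<^sup>2 \<le> L\<^sub>z\<^sup>2 * (d k + 4 * u (Suc k))"
        using dist by (intro mult_left_mono) auto
      ultimately show ?thesis using z_err[of k] by (simp add: power_mult_distrib)
    qed
  qed (use small lower L_pos \<Lambda>0 \<Theta>0 in \<open>auto simp: n_def d_def u_def v_def\<close>)
  then show ?thesis
    by (simp add: n_def u_def v_def init y_def X_def[symmetric] amigo_x_def s_def[symmetric] init_err_y_def
        init_err_z_def steps)
qed

end

section \<open>Dependence of the constants on the condition number\<close>

lemma ln_le_power:
  fixes X Y \<kappa> :: real
  assumes "0 < X" "0 < Y" "0 < \<kappa>" "X \<le> \<kappa> ^ n * Y"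
  shows "ln X \<le> ln Y + real n * ln \<kappa>"
proof -
  have "ln X \<le> ln (\<kappa> ^ n * Y)" using assms by simp
  also have "\<dots> = real n * ln \<kappa> + ln Y" using assms by (simp add: ln_mult ln_realpow)
  finally show ?thesis by simp
qed

lemma max_le_max_add:
  fixes a b a' b' c :: real
  assumes "a \<le> a' + c" "b \<le> b' + c"
  shows "max a b \<le> max a' b' + c"
  using assms by linarith

text \<open>Each of \<open>a\<close> and \<open>b\<close> is at most \<open>exp (c / 2)\<close>;
  here the factors 2 in front of the logarithms in \<open>C_const\<close> and
  \<open>C'_const\<close> are spent.\<close>

lemma exp_neg_mult_le_one:
  fixes a b c :: real
  assumes "1 \<le> a" "1 \<le> b" "2 * ln a \<le> c" "2 * ln b \<le> c"
  shows "exp (- c) * (a * b) \<le> 1"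
proof -
  have "ln (a * b) \<le> c" using assms by (simp add: ln_mult)
  then have "a * b \<le> exp c" using assms by (metis exp_le_cancel_iff exp_ln mult_pos_pos zero_less_one less_le_trans)
  then show ?thesis by (simp add: exp_minus field_simps)
qed

lemma Max_three: "Max {a, b, c} = max a (max b c)" for a b c :: real
  by simp

text \<open>With \<open>\<eta>\<^sub>0 = L\<close> and \<open>\<zeta>\<^sub>0 = 2 * L\<close> the
  maximum inside \<open>C2\<close> is \<open>16 * L\<close>, whence the coefficient 64. Nested
  binary maxima suit the entrywise comparison by \<open>max_le_max_add\<close>.\<close>

lemma C_const_eq:
  assumes "0 < L_const Lf B Lg' Mg m"
  shows "C_const Lf B Lg' Mg m =
    (let Ly = Ly_const Lg' m; P = Lpsi_const Lf B Lg' Mg m; L = L_const Lf B Lg' Mg m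
     in max (1 + 2 * ln (6 + 24 * P\<^sup>2 / L)) (max (2 * ln (1 + 64 * Ly\<^sup>2 / L))
         (max 0 (max (- 2 * ln (5 * P\<^sup>2 / L)) (- 2 * ln (L / (4 * Ly\<^sup>2)))))))"
proof -
  have "4 * y / l\<^sup>2 * max l (8 * (2 * l)) = 64 * y / l" if "0 < l" for y l :: real
    using that by (simp add: power2_eq_square)
  from this[OF assms] show ?thesis by (simp only: C_const_def Let_def Max_three)
qed

lemma C'_const_eq:
  "C'_const Lf B Lg' Mg m =
    (let Ly = Ly_const Lg' m; Lz = Lz_const Lf B Mg m; P = Lpsi_const Lf B Lg' Mg m;
         L = L_const Lf B Lg' Mg m
     in max (1 + 2 * ln (4 + 24 * P\<^sup>2 / L)) (max (2 * ln (1 + 2 * Lz\<^sup>2 / Ly\<^sup>2 * (1 + 16 * Ly\<^sup>2)))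
         (max 0 (max (- 2 * ln (P\<^sup>2 / (4 * Lz\<^sup>2 * L))) (- 2 * ln (1 / L * Lg'\<^sup>2))))))"
  by (simp only: C'_const_def Let_def Max_three)

lemma C_const_lower:
  assumes "0 < L_const Lf B Lg' Mg m"
  shows "1 + 2 * ln (6 + 24 * (Lpsi_const Lf B Lg' Mg m)\<^sup>2 / L_const Lf B Lg' Mg m) \<le> C_const Lf B Lg' Mg m"
    and "2 * ln (1 + 64 * (Ly_const Lg' m)\<^sup>2 / L_const Lf B Lg' Mg m) \<le> C_const Lf B Lg' Mg m"
  unfolding C_const_eq[OF assms] Let_def
  by (rule max.cobounded1, rule max.coboundedI2[OF max.cobounded1])

lemma C'_const_lower:
  "1 + 2 * ln (4 + 24 * (Lpsi_const Lf B Lg' Mg m)\<^sup>2 / L_const Lf B Lg' Mg m) \<le> C'_const Lf B Lg' Mg m"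
  "2 * ln (1 + 2 * (Lz_const Lf B Mg m)\<^sup>2 / (Ly_const Lg' m)\<^sup>2 * (1 + 16 * (Ly_const Lg' m)\<^sup>2))
    \<le> C'_const Lf B Lg' Mg m"
  unfolding C'_const_eq Let_def
  by (rule max.cobounded1, rule max.coboundedI2[OF max.cobounded1])

lemma C_const_ge_1:
  assumes "0 < L_const Lf B Lg' Mg m"
  shows "1 \<le> C_const Lf B Lg' Mg m"
proof -
  have "0 \<le> ln (6 + 24 * (Lpsi_const Lf B Lg' Mg m)\<^sup>2 / L_const Lf B Lg' Mg m)"
    using assms by (intro ln_ge_zero) (simp add: add_increasing2)
  then show ?thesis using C_const_lower(1)[OF assms] by linarith
qed

lemma C'_const_ge_1:
  assumes "0 < L_const Lf B Lg' Mg m"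
  shows "1 \<le> C'_const Lf B Lg' Mg m"
proof -
  have "0 \<le> ln (4 + 24 * (Lpsi_const Lf B Lg' Mg m)\<^sup>2 / L_const Lf B Lg' Mg m)"
    using assms by (intro ln_ge_zero) (simp add: add_increasing2)
  then show ?thesis using C'_const_lower(1)[of Lf B Lg' Mg m] by linarith
qed

context bilevel
begin

definition "\<kappa> = Lg / \<mu>g"

abbreviation "L\<^sub>y\<^sub>1 \<equiv> Ly_const Lg' Lg"
abbreviation "L\<^sub>z\<^sub>1 \<equiv> Lz_const Lf B Mg Lg"
abbreviation "L\<^sub>\<psi>\<^sub>1 \<equiv> Lpsi_const Lf B Lg' Mg Lg"
abbreviation "L\<^sub>1 \<equiv> L_const Lf B Lg' Mg Lg"
abbreviation "C \<equiv> C_const Lf B Lg' Mg \<mu>g"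
abbreviation "C' \<equiv> C'_const Lf B Lg' Mg \<mu>g"
abbreviation "C\<^sub>1 \<equiv> C_const Lf B Lg' Mg Lg"
abbreviation "C'\<^sub>1 \<equiv> C'_const Lf B Lg' Mg Lg"

lemma \<kappa>_ge_1: "1 \<le> \<kappa>"
  using \<mu>g_le_Lg constants(4) by (simp add: \<kappa>_def)

lemma Ly_scale: "L\<^sub>y = \<kappa> * L\<^sub>y\<^sub>1" and Ly_pos: "0 < L\<^sub>y" "0 < L\<^sub>y\<^sub>1"
  using Lg_pos constants by (auto simp: Ly_const_def \<kappa>_def)

text \<open>Relative to \<open>1 / Lg\<close>, each power of \<open>1 / \<mu>g\<close> is a power of
  \<open>\<kappa>\<close>, so \<open>L\<^sub>z\<close> becomes
  \<open>\<kappa>\<^sup>2 * a + \<kappa> * b\<close>; \<open>L\<^sub>\<psi>\<close> and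
  \<open>L\<close> are treated alike. The constants occur in numerators and in denominators of
  logarithms, which calls for comparisons in both directions.\<close>

lemma Lz_bounds: "L\<^sub>z\<^sub>1 \<le> L\<^sub>z" "L\<^sub>z \<le> \<kappa>\<^sup>2 * L\<^sub>z\<^sub>1"
  and Lz_pos: "0 < L\<^sub>z" "0 < L\<^sub>z\<^sub>1"
proof -
  define a where "a = Mg * B / Lg\<^sup>2"
  define b where "b = Lf / Lg"
  have ab: "0 \<le> a" "0 \<le> b" using constants Lg_pos by (auto simp: a_def b_def)
  have k: "\<kappa> \<le> \<kappa>\<^sup>2" "1 \<le> \<kappa>\<^sup>2"
    using \<kappa>_ge_1 self_le_power[of \<kappa> 2] one_le_power[of \<kappa> 2] by auto
  have z1: "L\<^sub>z\<^sub>1 = a + b" by (simp add: Lz_const_def a_def b_def)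
  have z: "L\<^sub>z = \<kappa>\<^sup>2 * a + \<kappa> * b"
    using Lg_pos constants(4) by (simp add: Lz_const_def a_def b_def \<kappa>_def power_divide)
  show "L\<^sub>z\<^sub>1 \<le> L\<^sub>z" unfolding z z1
    using ab k \<kappa>_ge_1 mult_right_mono[of 1 "\<kappa>\<^sup>2" a] mult_right_mono[of 1 \<kappa> b] by simp
  show "L\<^sub>z \<le> \<kappa>\<^sup>2 * L\<^sub>z\<^sub>1" unfolding z z1
    using ab k mult_right_mono[of \<kappa> "\<kappa>\<^sup>2" b] by (simp add: distrib_left)
  have "0 < a + b"
  proof (cases "Lf = 0")
    case True
    then show ?thesis using constants Lg_pos ab by (auto simp: a_def b_def intro!: divide_pos_pos)
  next
    case False
    then show ?thesis using constants Lg_pos ab by (auto simp: b_def intro!: add_nonneg_pos)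
  qed
  then show "0 < L\<^sub>z\<^sub>1" "0 < L\<^sub>z" using \<open>L\<^sub>z\<^sub>1 \<le> L\<^sub>z\<close> z1 by auto
qed

lemma Lpsi_bounds: "L\<^sub>\<psi>\<^sub>1 \<le> L\<^sub>\<psi>" "L\<^sub>\<psi> \<le> \<kappa>\<^sup>2 * L\<^sub>\<psi>\<^sub>1"
  and Lpsi_pos: "0 < L\<^sub>\<psi>" "0 < L\<^sub>\<psi>\<^sub>1"
proof -
  define c where "c = Mg * B / Lg"
  have c: "0 \<le> c" using constants Lg_pos by (simp add: c_def)
  have k: "1 \<le> \<kappa>" "\<kappa> \<le> \<kappa>\<^sup>2" "1 \<le> \<kappa>\<^sup>2"
    using \<kappa>_ge_1 self_le_power[of \<kappa> 2] one_le_power[of \<kappa> 2] by auto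
  have p1: "L\<^sub>\<psi>\<^sub>1 = max (Lf + c + Lg' * L\<^sub>z\<^sub>1) Lg'" by (simp add: Lpsi_const_def c_def)
  have p: "L\<^sub>\<psi> = max (Lf + \<kappa> * c + Lg' * L\<^sub>z) Lg'"
    using Lg_pos by (simp add: Lpsi_const_def c_def \<kappa>_def)
  have "c \<le> \<kappa> * c" using mult_right_mono[OF k(1) c] by simp
  moreover have "Lg' * L\<^sub>z\<^sub>1 \<le> Lg' * L\<^sub>z" using Lz_bounds constants by (intro mult_left_mono) auto
  ultimately show "L\<^sub>\<psi>\<^sub>1 \<le> L\<^sub>\<psi>" unfolding p p1 by linarith
  have "Lf \<le> \<kappa>\<^sup>2 * Lf" "Lg' \<le> \<kappa>\<^sup>2 * Lg'" "\<kappa> * c \<le> \<kappa>\<^sup>2 * c"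
    using mult_right_mono[OF k(3), of Lf] mult_right_mono[OF k(3), of Lg'] mult_right_mono[OF k(2) c]
      constants by auto
  moreover have "Lg' * L\<^sub>z \<le> Lg' * (\<kappa>\<^sup>2 * L\<^sub>z\<^sub>1)" using Lz_bounds constants by (intro mult_left_mono) auto
  moreover have "\<kappa>\<^sup>2 * (Lf + c + Lg' * L\<^sub>z\<^sub>1) \<le> \<kappa>\<^sup>2 * L\<^sub>\<psi>\<^sub>1" "\<kappa>\<^sup>2 * Lg' \<le> \<kappa>\<^sup>2 * L\<^sub>\<psi>\<^sub>1"
    unfolding p1 by (intro mult_left_mono; simp)+
  ultimately show "L\<^sub>\<psi> \<le> \<kappa>\<^sup>2 * L\<^sub>\<psi>\<^sub>1" unfolding p by (simp add: algebra_simps)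
  show "0 < L\<^sub>\<psi>" "0 < L\<^sub>\<psi>\<^sub>1" using constants unfolding p p1 by auto
qed

text \<open>The first factor of \<open>L\<close> grows at most like \<open>\<kappa>\<^sup>2\<close>,
  the second at most like \<open>\<kappa>\<close>.\<close>

lemma L_bounds: "L\<^sub>1 \<le> L" "L \<le> \<kappa> ^ 3 * L\<^sub>1"
  and L1_pos: "0 < L\<^sub>1"
proof -
  define a b c where "a = Lg' * Mg * B / Lg\<^sup>2" and "b = (Lg' * Lf + Mg * B) / Lg" and "c = Lg' / Lg"
  have abc: "0 \<le> a" "0 \<le> b" "0 \<le> c" using constants Lg_pos by (auto simp: a_def b_def c_def)
  have k: "1 \<le> \<kappa>" "\<kappa> \<le> \<kappa>\<^sup>2" "1 \<le> \<kappa>\<^sup>2"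
    using \<kappa>_ge_1 self_le_power[of \<kappa> 2] one_le_power[of \<kappa> 2] by auto
  have l1: "L\<^sub>1 = (Lf + a + b) * (1 + c)" by (simp add: L_const_def a_def b_def c_def)
  have l: "L = (Lf + \<kappa>\<^sup>2 * a + \<kappa> * b) * (1 + \<kappa> * c)"
    using Lg_pos constants(4) by (simp add: L_const_def a_def b_def c_def \<kappa>_def power_divide)
  have le: "a \<le> \<kappa>\<^sup>2 * a" "b \<le> \<kappa> * b" "c \<le> \<kappa> * c" "\<kappa> * b \<le> \<kappa>\<^sup>2 * b" "Lf \<le> \<kappa>\<^sup>2 * Lf"
    using mult_right_mono[OF k(3) abc(1)] mult_right_mono[OF k(1) abc(2)] mult_right_mono[OF k(1) abc(3)]
      mult_right_mono[OF k(2) abc(2)] mult_right_mono[OF k(3) constants(1)] by simp_all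
  show "L\<^sub>1 \<le> L" unfolding l l1
    using le abc constants by (intro mult_mono) auto
  have "L \<le> (\<kappa>\<^sup>2 * (Lf + a + b)) * (\<kappa> * (1 + c))"
    unfolding l using le abc constants k by (intro mult_mono) (auto simp: distrib_left intro!: add_nonneg_nonneg)
  also have "\<dots> = \<kappa> ^ 3 * L\<^sub>1" unfolding l1 by (simp add: power2_eq_square power3_eq_cube)
  finally show "L \<le> \<kappa> ^ 3 * L\<^sub>1" .
  then have "0 < \<kappa> ^ 3 * L\<^sub>1" using L_pos by linarith
  then show "0 < L\<^sub>1" using k by (simp add: zero_less_mult_iff)
qed

lemma C_ge_1: "1 \<le> C" "1 \<le> C'" "1 \<le> C\<^sub>1" "1 \<le> C'\<^sub>1"
  using C_const_ge_1 C'_const_ge_1 L_pos L1_pos by blast+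

lemma ln_\<kappa>_nonneg: "0 \<le> ln \<kappa>"
  using \<kappa>_ge_1 by simp

lemma constants_squared_bounds:
  "L\<^sub>\<psi>\<^sup>2 \<le> \<kappa> ^ 4 * L\<^sub>\<psi>\<^sub>1\<^sup>2" "L\<^sub>\<psi>\<^sub>1\<^sup>2 \<le> L\<^sub>\<psi>\<^sup>2" "L\<^sub>z\<^sup>2 \<le> \<kappa> ^ 4 * L\<^sub>z\<^sub>1\<^sup>2" "L\<^sub>y\<^sup>2 = \<kappa>\<^sup>2 * L\<^sub>y\<^sub>1\<^sup>2"
proof -
  have eq: "(\<kappa>\<^sup>2 * a)\<^sup>2 = \<kappa> ^ 4 * a\<^sup>2" for a by (simp add: power_mult_distrib power_mult[symmetric])
  have "L\<^sub>\<psi>\<^sup>2 \<le> (\<kappa>\<^sup>2 * L\<^sub>\<psi>\<^sub>1)\<^sup>2" "L\<^sub>z\<^sup>2 \<le> (\<kappa>\<^sup>2 * L\<^sub>z\<^sub>1)\<^sup>2"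
    using Lpsi_bounds Lz_bounds Lpsi_pos Lz_pos by (intro power_mono; linarith)+
  then show "L\<^sub>\<psi>\<^sup>2 \<le> \<kappa> ^ 4 * L\<^sub>\<psi>\<^sub>1\<^sup>2" "L\<^sub>z\<^sup>2 \<le> \<kappa> ^ 4 * L\<^sub>z\<^sub>1\<^sup>2" by (simp_all only: eq)
  show "L\<^sub>\<psi>\<^sub>1\<^sup>2 \<le> L\<^sub>\<psi>\<^sup>2" using Lpsi_bounds Lpsi_pos by (intro power_mono) auto
  show "L\<^sub>y\<^sup>2 = \<kappa>\<^sup>2 * L\<^sub>y\<^sub>1\<^sup>2" by (simp add: Ly_scale power_mult_distrib)
qed

lemma psi_ratio_bound: "24 * L\<^sub>\<psi>\<^sup>2 / L \<le> \<kappa> ^ 4 * (24 * L\<^sub>\<psi>\<^sub>1\<^sup>2 / L\<^sub>1)"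
proof -
  have "24 * L\<^sub>\<psi>\<^sup>2 / L \<le> (24 * (\<kappa> ^ 4 * L\<^sub>\<psi>\<^sub>1\<^sup>2)) / L\<^sub>1"
    using constants_squared_bounds L_bounds L1_pos by (intro frac_le) auto
  then show ?thesis by (simp add: mult_ac)
qed

lemma ln_affine_bound:
  fixes a b b' :: real
  assumes "0 < a" "0 \<le> b" "0 \<le> b'" "b \<le> \<kappa> ^ n * b'" "n \<le> 4"
  shows "2 * ln (a + b) \<le> 2 * ln (a + b') + 8 * ln \<kappa>"
proof -
  have "a * 1 \<le> a * \<kappa> ^ n" using assms \<kappa>_ge_1 one_le_power[of \<kappa> n] by (intro mult_left_mono) auto
  moreover have "\<kappa> ^ n * (a + b') = a * \<kappa> ^ n + \<kappa> ^ n * b'" by (simp add: algebra_simps)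
  ultimately have "a + b \<le> \<kappa> ^ n * (a + b')" using assms(4) by linarith
  then have "ln (a + b) \<le> ln (a + b') + real n * ln \<kappa>"
    using assms \<kappa>_ge_1 by (intro ln_le_power) auto
  also have "real n * ln \<kappa> \<le> 4 * ln \<kappa>" using assms ln_\<kappa>_nonneg by (intro mult_right_mono) auto
  finally show ?thesis by simp
qed

text \<open>The maxima are compared entry by entry. The fastest growth is the fourth power of
  \<open>\<kappa>\<close> in \<open>L\<^sub>\<psi>\<^sup>2\<close>, under a doubled
  logarithm.\<close>

lemma C_bound: "C \<le> C\<^sub>1 + 8 * ln \<kappa>"
proof -
  have 1: "1 + 2 * ln (6 + 24 * L\<^sub>\<psi>\<^sup>2 / L) \<le> 1 + 2 * ln (6 + 24 * L\<^sub>\<psi>\<^sub>1\<^sup>2 / L\<^sub>1) + 8 * ln \<kappa>"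
    using ln_affine_bound[of 6 "24 * L\<^sub>\<psi>\<^sup>2 / L" "24 * L\<^sub>\<psi>\<^sub>1\<^sup>2 / L\<^sub>1" 4] psi_ratio_bound L_pos L1_pos
    by simp
  have "64 * L\<^sub>y\<^sup>2 / L \<le> 64 * (\<kappa>\<^sup>2 * L\<^sub>y\<^sub>1\<^sup>2) / L\<^sub>1"
    unfolding constants_squared_bounds using L_bounds L1_pos by (intro frac_le) auto
  then have 2: "2 * ln (1 + 64 * L\<^sub>y\<^sup>2 / L) \<le> 2 * ln (1 + 64 * L\<^sub>y\<^sub>1\<^sup>2 / L\<^sub>1) + 8 * ln \<kappa>"
    using L_pos L1_pos by (intro ln_affine_bound[where n = 2]) (auto simp: mult_ac)
  have "5 * L\<^sub>\<psi>\<^sub>1\<^sup>2 / L\<^sub>1 \<le> \<kappa> ^ 3 * (5 * L\<^sub>\<psi>\<^sup>2 / L)"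
  proof -
    have "L\<^sub>\<psi>\<^sub>1\<^sup>2 * L \<le> L\<^sub>\<psi>\<^sup>2 * (\<kappa> ^ 3 * L\<^sub>1)"
      using constants_squared_bounds L_bounds L_pos by (intro mult_mono) auto
    then show ?thesis using L_pos L1_pos by (simp add: field_simps)
  qed
  then have "ln (5 * L\<^sub>\<psi>\<^sub>1\<^sup>2 / L\<^sub>1) \<le> ln (5 * L\<^sub>\<psi>\<^sup>2 / L) + real 3 * ln \<kappa>"
    using L_pos L1_pos Lpsi_pos \<kappa>_ge_1 by (intro ln_le_power) auto
  then have 3: "- 2 * ln (5 * L\<^sub>\<psi>\<^sup>2 / L) \<le> - 2 * ln (5 * L\<^sub>\<psi>\<^sub>1\<^sup>2 / L\<^sub>1) + 8 * ln \<kappa>"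
    using ln_\<kappa>_nonneg by linarith
  have "L\<^sub>1 / (4 * L\<^sub>y\<^sub>1\<^sup>2) \<le> \<kappa>\<^sup>2 * (L / (4 * L\<^sub>y\<^sup>2))"
    unfolding constants_squared_bounds using \<kappa>_ge_1 L_bounds Ly_pos by (simp add: divide_right_mono)
  then have "ln (L\<^sub>1 / (4 * L\<^sub>y\<^sub>1\<^sup>2)) \<le> ln (L / (4 * L\<^sub>y\<^sup>2)) + real 2 * ln \<kappa>"
    using L_pos L1_pos Ly_pos \<kappa>_ge_1 by (intro ln_le_power) auto
  then have 4: "- 2 * ln (L / (4 * L\<^sub>y\<^sup>2)) \<le> - 2 * ln (L\<^sub>1 / (4 * L\<^sub>y\<^sub>1\<^sup>2)) + 8 * ln \<kappa>"
    using ln_\<kappa>_nonneg by linarith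
  show ?thesis
    unfolding C_const_eq[OF L_pos] C_const_eq[OF L1_pos] Let_def
    using ln_\<kappa>_nonneg by (intro max_le_max_add 1 2 3 4) simp
qed

text \<open>The 14 stems from the entry with \<open>L\<^sub>z\<^sup>2 * L\<close> in a denominator:
  the exponents 4 and 3 add up to 7, and the logarithm is doubled.\<close>

lemma C'_bound: "C' \<le> C'\<^sub>1 + 14 * ln \<kappa>"
proof -
  have 1: "1 + 2 * ln (4 + 24 * L\<^sub>\<psi>\<^sup>2 / L) \<le> 1 + 2 * ln (4 + 24 * L\<^sub>\<psi>\<^sub>1\<^sup>2 / L\<^sub>1) + 14 * ln \<kappa>"
    using ln_affine_bound[of 4 "24 * L\<^sub>\<psi>\<^sup>2 / L" "24 * L\<^sub>\<psi>\<^sub>1\<^sup>2 / L\<^sub>1" 4] psi_ratio_bound L_pos L1_pos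
      ln_\<kappa>_nonneg by simp
  \<comment> \<open>In this form \<open>L\<^sub>y\<close> enters only through its reciprocal, which
    is largest at condition number 1; all growth comes from
    \<open>L\<^sub>z\<^sup>2\<close>.\<close>
  have "2 * L\<^sub>z\<^sup>2 / L\<^sub>y\<^sup>2 * (1 + 16 * L\<^sub>y\<^sup>2) = 2 * (L\<^sub>z\<^sup>2 * (1 / L\<^sub>y\<^sup>2 + 16))"
    using Ly_pos by (simp add: field_simps)
  also have "\<dots> \<le> 2 * ((\<kappa> ^ 4 * L\<^sub>z\<^sub>1\<^sup>2) * (1 / L\<^sub>y\<^sub>1\<^sup>2 + 16))"
  proof -
    have "L\<^sub>y\<^sub>1\<^sup>2 \<le> L\<^sub>y\<^sup>2"
      unfolding constants_squared_bounds
      using mult_right_mono[of 1 "\<kappa>\<^sup>2" "L\<^sub>y\<^sub>1\<^sup>2"] \<kappa>_ge_1 one_le_power[of \<kappa> 2] by simp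
    then have "1 / L\<^sub>y\<^sup>2 \<le> 1 / L\<^sub>y\<^sub>1\<^sup>2" using Ly_pos by (intro divide_left_mono) auto
    then show ?thesis using constants_squared_bounds by (intro mult_left_mono mult_mono) auto
  qed
  also have "\<dots> = \<kappa> ^ 4 * (2 * L\<^sub>z\<^sub>1\<^sup>2 / L\<^sub>y\<^sub>1\<^sup>2 * (1 + 16 * L\<^sub>y\<^sub>1\<^sup>2))"
    using Ly_pos by (simp add: field_simps)
  finally have 2: "2 * ln (1 + 2 * L\<^sub>z\<^sup>2 / L\<^sub>y\<^sup>2 * (1 + 16 * L\<^sub>y\<^sup>2))
      \<le> 2 * ln (1 + 2 * L\<^sub>z\<^sub>1\<^sup>2 / L\<^sub>y\<^sub>1\<^sup>2 * (1 + 16 * L\<^sub>y\<^sub>1\<^sup>2)) + 14 * ln \<kappa>"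
    using ln_affine_bound[of 1 "2 * L\<^sub>z\<^sup>2 / L\<^sub>y\<^sup>2 * (1 + 16 * L\<^sub>y\<^sup>2)"
        "2 * L\<^sub>z\<^sub>1\<^sup>2 / L\<^sub>y\<^sub>1\<^sup>2 * (1 + 16 * L\<^sub>y\<^sub>1\<^sup>2)" 4] ln_\<kappa>_nonneg by simp
  have "L\<^sub>\<psi>\<^sub>1\<^sup>2 / (4 * L\<^sub>z\<^sub>1\<^sup>2 * L\<^sub>1) \<le> \<kappa> ^ 7 * (L\<^sub>\<psi>\<^sup>2 / (4 * L\<^sub>z\<^sup>2 * L))"
  proof -
    have "L\<^sub>z\<^sup>2 * L \<le> (\<kappa> ^ 4 * L\<^sub>z\<^sub>1\<^sup>2) * (\<kappa> ^ 3 * L\<^sub>1)"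
      using constants_squared_bounds L_bounds L_pos by (intro mult_mono) auto
    then have "L\<^sub>\<psi>\<^sub>1\<^sup>2 * (L\<^sub>z\<^sup>2 * L) \<le> L\<^sub>\<psi>\<^sup>2 * ((\<kappa> ^ 4 * L\<^sub>z\<^sub>1\<^sup>2) * (\<kappa> ^ 3 * L\<^sub>1))"
      using constants_squared_bounds L_pos by - (rule mult_mono, auto)
    also have "\<dots> = \<kappa> ^ 7 * L\<^sub>\<psi>\<^sup>2 * (L\<^sub>z\<^sub>1\<^sup>2 * L\<^sub>1)"
      by (simp add: power_add[of \<kappa> 4 3, simplified])
    finally show ?thesis using L_pos L1_pos Lz_pos
      by (simp add: divide_le_eq le_divide_eq mult_ac)
  qed
  then have "ln (L\<^sub>\<psi>\<^sub>1\<^sup>2 / (4 * L\<^sub>z\<^sub>1\<^sup>2 * L\<^sub>1)) \<le> ln (L\<^sub>\<psi>\<^sup>2 / (4 * L\<^sub>z\<^sup>2 * L)) + real 7 * ln \<kappa>"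
    using L_pos L1_pos Lpsi_pos Lz_pos \<kappa>_ge_1 by (intro ln_le_power) auto
  then have 3: "- 2 * ln (L\<^sub>\<psi>\<^sup>2 / (4 * L\<^sub>z\<^sup>2 * L)) \<le> - 2 * ln (L\<^sub>\<psi>\<^sub>1\<^sup>2 / (4 * L\<^sub>z\<^sub>1\<^sup>2 * L\<^sub>1)) + 14 * ln \<kappa>"
    by linarith
  have "1 / L\<^sub>1 * Lg'\<^sup>2 \<le> \<kappa> ^ 3 * (1 / L * Lg'\<^sup>2)"
    using mult_right_mono[OF L_bounds(2), of "Lg'\<^sup>2"] L_pos L1_pos by (simp add: field_simps)
  then have "ln (1 / L\<^sub>1 * Lg'\<^sup>2) \<le> ln (1 / L * Lg'\<^sup>2) + real 3 * ln \<kappa>"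
    using L_pos L1_pos constants \<kappa>_ge_1 by (intro ln_le_power) auto
  then have 4: "- 2 * ln (1 / L * Lg'\<^sup>2) \<le> - 2 * ln (1 / L\<^sub>1 * Lg'\<^sup>2) + 14 * ln \<kappa>"
    using ln_\<kappa>_nonneg by linarith
  show ?thesis
    unfolding C'_const_eq Let_def
    using ln_\<kappa>_nonneg by (intro max_le_max_add 1 2 3 4) simp
qed

section \<open>The inner iteration counts and the total cost\<close>

abbreviation "T \<equiv> T_iter Lf B Lg Lg' Mg \<mu>g"
abbreviation "N \<equiv> N_iter Lf B Lg Lg' Mg \<mu>g"
abbreviation "K \<equiv> inner_O_const Lf B Lg Lg' Mg"

lemma iter_bounds:
  shows T_lower: "\<kappa> * C \<le> real T" and T_upper: "real T \<le> \<kappa> * C + 1"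
    and N_lower: "4 * (\<kappa> * (C + C')) \<le> real N" and N_upper: "real N \<le> 4 * (\<kappa> * (C + C')) + 1"
proof -
  have T: "T = nat \<lfloor>\<kappa> * C\<rfloor> + 1" by (simp add: T_iter_def \<kappa>_def Let_def mult_ac)
  have N: "N = nat \<lfloor>4 * (\<kappa> * (C + C'))\<rfloor> + 1" by (simp add: N_iter_def \<kappa>_def Let_def mult_ac)
  have nat: "r \<le> real (nat \<lfloor>r\<rfloor> + 1)" "real (nat \<lfloor>r\<rfloor> + 1) \<le> r + 1" if "0 \<le> r" for r :: real
    using that by linarith+
  have "0 \<le> \<kappa> * C" "0 \<le> 4 * (\<kappa> * (C + C'))" using \<kappa>_ge_1 C_ge_1 by auto
  then show "\<kappa> * C \<le> real T" "real T \<le> \<kappa> * C + 1" "4 * (\<kappa> * (C + C')) \<le> real N"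
    "real N \<le> 4 * (\<kappa> * (C + C')) + 1"
    unfolding T N using nat by blast+
qed

lemma inner_iterations_bound:
  "real T \<le> K * (1 + ln \<kappa>) * \<kappa>" "real N \<le> K * (1 + ln \<kappa>) * \<kappa>"
proof -
  \<comment> \<open>88 is \<open>4 * (8 + 14)\<close>, from the two logarithmic growth bounds; the
    100 in \<open>inner_O_const\<close> leaves room for it.\<close>
  have "4 * (C + C') + 1 \<le> 4 * (C\<^sub>1 + C'\<^sub>1) + 88 * ln \<kappa> + 1" using C_bound C'_bound by simp
  also have "\<dots> \<le> K + K * ln \<kappa>"
  proof -
    have "88 \<le> K" using C_ge_1 by (simp add: inner_O_const_def)
    then have "88 * ln \<kappa> \<le> K * ln \<kappa>" using ln_\<kappa>_nonneg by (rule mult_right_mono)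
    moreover have "4 * (C\<^sub>1 + C'\<^sub>1) + 1 \<le> K" using C_ge_1 by (simp add: inner_O_const_def)
    ultimately show ?thesis by linarith
  qed
  finally have "\<kappa> * (4 * (C + C') + 1) \<le> \<kappa> * (K + K * ln \<kappa>)" using \<kappa>_ge_1 by (intro mult_left_mono) auto
  then have *: "4 * (\<kappa> * (C + C')) + \<kappa> \<le> K * (1 + ln \<kappa>) * \<kappa>" by (simp add: algebra_simps)
  then show "real N \<le> K * (1 + ln \<kappa>) * \<kappa>" using N_upper \<kappa>_ge_1 by linarith
  have "\<kappa> * C \<le> \<kappa> * (4 * (C + C'))" using \<kappa>_ge_1 C_ge_1 by (intro mult_left_mono) auto
  then show "real T \<le> K * (1 + ln \<kappa>) * \<kappa>" using * T_upper \<kappa>_ge_1 by linarith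
qed

text \<open>\<open>E = exp (- C)\<close> beats any product of two of \<open>6 + a\<close> and
  \<open>1 + b\<close>, and \<open>E' = exp (- C')\<close> beats \<open>(4 + a) * (1 + b')\<close>.
  \<open>\<Lambda>\<close> is below \<open>E\<close> and \<open>\<Theta>\<close> below
  \<open>E * E'\<close>; the bounds are read off by keeping a single monomial of such a
  product.\<close>

lemma contraction_factors_small:
  defines "\<Lambda> \<equiv> (1 - \<mu>g / Lg) ^ T" and "\<Theta> \<equiv> (1 - 3 / 4 * (\<mu>g / Lg)) ^ N"
  shows "\<Lambda> \<le> 1 / 4" "\<Theta> \<le> 1 / 4" "L\<^sub>\<psi>\<^sup>2 * \<Lambda> \<le> L / 64" "L\<^sub>\<psi>\<^sup>2 * \<Lambda> * L\<^sub>y\<^sup>2 \<le> L\<^sup>2 / 1024"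
    "L\<^sub>\<psi>\<^sup>2 * \<Theta> \<le> L / 64" "L\<^sub>\<psi>\<^sup>2 * \<Theta> * L\<^sub>z\<^sup>2 \<le> L / 768"
    "L\<^sub>\<psi>\<^sup>2 * \<Theta> * (L\<^sub>z\<^sup>2 * (1 + 16 * L\<^sub>y\<^sup>2)) \<le> L\<^sup>2 / 1024"
proof -
  have q: "0 \<le> \<mu>g / Lg" "\<mu>g / Lg \<le> 1" using \<mu>g_le_Lg Lg_pos constants(4) by auto
  have \<kappa>q: "\<mu>g / Lg * \<kappa> = 1" using Lg_pos constants(4) by (simp add: \<kappa>_def)
  have \<Lambda>: "\<Lambda> \<le> exp (- C)"
  proof -
    have "\<mu>g / Lg * (\<kappa> * C) \<le> \<mu>g / Lg * real T" using T_lower q by (intro mult_left_mono) auto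
    moreover have "\<mu>g / Lg * (\<kappa> * C) = C" using \<kappa>q by (metis mult.assoc mult_1)
    ultimately show ?thesis unfolding \<Lambda>_def using q by (intro one_minus_power_le_exp) auto
  qed
  have \<Theta>: "\<Theta> \<le> exp (- (C + C'))"
  proof -
    have "\<mu>g / Lg * (4 * (\<kappa> * (C + C'))) \<le> \<mu>g / Lg * real N" using N_lower q by (intro mult_left_mono) auto
    moreover have "\<mu>g / Lg * (4 * (\<kappa> * (C + C'))) = 4 * (C + C')"
      using \<kappa>q by (metis mult.assoc mult.left_commute mult_1)
    moreover define t where "t = \<mu>g / Lg * real N"
    ultimately have "4 * (C + C') \<le> t" by simp
    \<comment> \<open>The factor 4 in \<open>N\<close> outweighs the loss of 3/4 in the contraction
      rate.\<close>
    then have "C + C' \<le> 3 / 4 * t" using C_ge_1 by simp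
    then have "C + C' \<le> 3 / 4 * (\<mu>g / Lg) * real N" by (simp add: t_def)
    then show ?thesis unfolding \<Theta>_def using q by (intro one_minus_power_le_exp) auto
  qed
  define a b b' where "a = 24 * L\<^sub>\<psi>\<^sup>2 / L" and "b = 64 * L\<^sub>y\<^sup>2 / L"
    and "b' = 2 * L\<^sub>z\<^sup>2 / L\<^sub>y\<^sup>2 * (1 + 16 * L\<^sub>y\<^sup>2)"
  have ab: "0 \<le> a" "0 \<le> b" "0 \<le> b'" using L_pos by (auto simp: a_def b_def b'_def)
  define E E' where "E = exp (- C)" and "E' = exp (- C')"
  have E0: "0 \<le> E" "0 \<le> E'" and "E' \<le> 1" using C_ge_1 by (auto simp: E_def E'_def)
  have EE': "\<Theta> \<le> E * E'" "\<Lambda> \<le> E" using \<Theta> \<Lambda> by (auto simp: E_def E'_def exp_add[symmetric])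
  have "E * E' \<le> E" using mult_left_mono[OF \<open>E' \<le> 1\<close> E0(1)] by simp
  then have \<Theta>E: "\<Theta> \<le> E" using EE' by simp
  have 1: "E * ((6 + a) * (6 + a)) \<le> 1" unfolding E_def
    using C_const_lower[OF L_pos] ab by (intro exp_neg_mult_le_one) (auto simp: a_def)
  have 2: "E * ((6 + a) * (1 + b)) \<le> 1" unfolding E_def
    using C_const_lower[OF L_pos] ab by (intro exp_neg_mult_le_one) (auto simp: a_def b_def)
  have 3: "E * ((1 + b) * (1 + b)) \<le> 1" unfolding E_def
    using C_const_lower[OF L_pos] ab by (intro exp_neg_mult_le_one) (auto simp: b_def)
  have 4: "E' * ((4 + a) * (1 + b')) \<le> 1" unfolding E'_def
    using C'_const_lower[where Lf = Lf and B = B and Lg' = Lg' and Mg = Mg and m = "\<mu>g"] ab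
    by (intro exp_neg_mult_le_one) (auto simp: a_def b'_def)
  have drop: "e * x \<le> 1" if "e * y \<le> 1" "x \<le> y" "0 \<le> e" for e x y :: real
    using mult_left_mono[OF that(2,3)] that(1) by linarith
  have "E * 36 \<le> 1" by (rule drop[OF 1]) (use ab E0 in \<open>auto simp: algebra_simps\<close>)
  then show "\<Lambda> \<le> 1 / 4" "\<Theta> \<le> 1 / 4" using EE' \<Theta>E by linarith+
  have "E * (12 * a) \<le> 1" by (rule drop[OF 1]) (use ab E0 in \<open>auto simp: algebra_simps\<close>)
  then have "L\<^sub>\<psi>\<^sup>2 * E \<le> L / 64" using L_pos by (simp add: a_def field_simps)
  then show "L\<^sub>\<psi>\<^sup>2 * \<Lambda> \<le> L / 64" "L\<^sub>\<psi>\<^sup>2 * \<Theta> \<le> L / 64"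
    using mult_left_mono[OF EE'(2), of "L\<^sub>\<psi>\<^sup>2"] mult_left_mono[OF \<Theta>E, of "L\<^sub>\<psi>\<^sup>2"] by auto
  have "E * (a * b) \<le> 1" by (rule drop[OF 2]) (use ab E0 in \<open>auto simp: algebra_simps\<close>)
  then have "L\<^sub>\<psi>\<^sup>2 * L\<^sub>y\<^sup>2 * E \<le> L\<^sup>2 / 1536"
    using L_pos by (simp add: a_def b_def field_simps power2_eq_square)
  also have "\<dots> \<le> L\<^sup>2 / 1024" by simp
  finally show "L\<^sub>\<psi>\<^sup>2 * \<Lambda> * L\<^sub>y\<^sup>2 \<le> L\<^sup>2 / 1024"
    using mult_left_mono[OF EE'(2), of "L\<^sub>\<psi>\<^sup>2 * L\<^sub>y\<^sup>2"] by (simp add: mult_ac)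
  have "E * b \<le> 1" by (rule drop[OF 3]) (use ab E0 in \<open>auto simp: algebra_simps\<close>)
  then have Eb: "E * L\<^sub>y\<^sup>2 \<le> L / 64" using L_pos by (simp add: b_def field_simps)
  have "E' * (a * b') \<le> 1" by (rule drop[OF 4]) (use ab E0 in \<open>auto simp: algebra_simps\<close>)
  \<comment> \<open>\<open>b'\<close> has \<open>L\<^sub>y\<^sup>2\<close> in its denominator, so
    that factor remains on the right. For the last bound it is removed by \<open>Eb\<close>, the
    contribution of the other exponential.\<close>
  then have E'ab: "L\<^sub>\<psi>\<^sup>2 * E' * (L\<^sub>z\<^sup>2 * (1 + 16 * L\<^sub>y\<^sup>2)) \<le> L * L\<^sub>y\<^sup>2 / 48"
    using L_pos Ly_pos by (simp add: a_def b'_def field_simps)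
  \<comment> \<open>Dropping the summand 1 leaves \<open>L\<^sub>y\<^sup>2\<close> on both sides,
    where it cancels; 768 is \<open>48 * 16\<close>.\<close>
  have "L\<^sub>\<psi>\<^sup>2 * E' * (L\<^sub>z\<^sup>2 * (16 * L\<^sub>y\<^sup>2)) \<le> L\<^sub>\<psi>\<^sup>2 * E' * (L\<^sub>z\<^sup>2 * (1 + 16 * L\<^sub>y\<^sup>2))"
    using E0 by (intro mult_left_mono) auto
  then have "(L\<^sub>\<psi>\<^sup>2 * E' * L\<^sub>z\<^sup>2) * (16 * L\<^sub>y\<^sup>2) \<le> (L / 768) * (16 * L\<^sub>y\<^sup>2)"
    using E'ab by (simp add: mult_ac)
  then have E'z: "L\<^sub>\<psi>\<^sup>2 * E' * L\<^sub>z\<^sup>2 \<le> L / 768" using Ly_pos by (simp add: mult_le_cancel_right)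
  have "E * E' \<le> E'" using mult_right_mono[of E 1 E'] \<open>E * 36 \<le> 1\<close> E0 by simp
  then have "\<Theta> \<le> E'" using EE' by simp
  then have "(L\<^sub>\<psi>\<^sup>2 * L\<^sub>z\<^sup>2) * \<Theta> \<le> (L\<^sub>\<psi>\<^sup>2 * L\<^sub>z\<^sup>2) * E'" by (intro mult_left_mono) auto
  then show "L\<^sub>\<psi>\<^sup>2 * \<Theta> * L\<^sub>z\<^sup>2 \<le> L / 768" using E'z by (simp add: mult_ac)
  have "L\<^sub>\<psi>\<^sup>2 * \<Theta> * (L\<^sub>z\<^sup>2 * (1 + 16 * L\<^sub>y\<^sup>2)) \<le> L\<^sub>\<psi>\<^sup>2 * (E * E') * (L\<^sub>z\<^sup>2 * (1 + 16 * L\<^sub>y\<^sup>2))"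
    using EE' by (intro mult_right_mono mult_left_mono) auto
  also have "\<dots> = E * (L\<^sub>\<psi>\<^sup>2 * E' * (L\<^sub>z\<^sup>2 * (1 + 16 * L\<^sub>y\<^sup>2)))" by (simp add: mult_ac)
  also have "\<dots> \<le> E * (L * L\<^sub>y\<^sup>2 / 48)" using E'ab E0 by (intro mult_left_mono) auto
  also have "\<dots> = (L / 48) * (E * L\<^sub>y\<^sup>2)" by simp
  also have "\<dots> \<le> (L / 48) * (L / 64)" using Eb L_pos by (intro mult_left_mono) auto
  also have "\<dots> \<le> L\<^sup>2 / 1024" by (simp add: power2_eq_square)
  finally show "L\<^sub>\<psi>\<^sup>2 * \<Theta> * (L\<^sub>z\<^sup>2 * (1 + 16 * L\<^sub>y\<^sup>2)) \<le> L\<^sup>2 / 1024" .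
qed

lemma amigo_complexity:
  fixes x0 :: "real^'dx" and y' z' :: "real^'dy"
  assumes steps: "\<And>k. \<alpha> k = 1 / Lg" "\<And>k. \<beta> k = 1 / (2 * Lg)" "\<And>k. \<gamma> k = 1 / L"
    and lower: "\<And>x. Lstar \<le> outer_obj f g x"
    and "0 < \<epsilon>"
  defines "\<Delta> \<equiv> outer_obj f g x0 - Lstar + init_err_y g x0 y' + init_err_z f g (\<alpha> 0) T x0 y' z'"
  shows "\<exists>k\<ge>1. (1 / real k) *
      (\<Sum>i=1..k. (norm (grad (outer_obj f g) (amigo_x f g \<alpha> \<beta> \<gamma> T N x0 y' z' i)))\<^sup>2) \<le> \<epsilon>
    \<and> real (complexity 1 1 1 1 T N k) \<le> max (real (complexity 1 1 1 1 T N 1))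
        (complexity_O_const Lf B Lg Lg' Mg * (1 + ln \<kappa>) * (\<kappa> ^ 4 / \<epsilon>) * \<Delta>)"
proof -
  define n where "n i = (norm (grad (outer_obj f g) (amigo_x f g \<alpha> \<beta> \<gamma> T N x0 y' z' i)))\<^sup>2" for i
  have \<Delta>0: "0 \<le> \<Delta>" using lower[of x0] by (simp add: \<Delta>_def init_err_y_def init_err_z_def)
  have "(\<Sum>i=1..k. n i) \<le> 4 * L * \<Delta>" for k
  proof -
    \<comment> \<open>The average starts at index 1, the summed bound at index 0; the extra term is
      nonnegative.\<close>
    have "(\<Sum>i=1..k. n i) \<le> (\<Sum>i<Suc k. n i)" by (rule sum_mono2) (auto simp: n_def)
    also have "\<dots> \<le> 4 * L * \<Delta>"
      unfolding n_def \<Delta>_def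
      by (rule amigo_sum_grad_bound[OF steps refl refl contraction_factors_small lower])
    finally show ?thesis .
  qed
  then have avg: "(1 / real k) * (\<Sum>i=1..k. n i) \<le> \<epsilon>" if "1 \<le> k" "4 * L * \<Delta> / \<epsilon> \<le> real k" for k
    using that \<open>0 < \<epsilon>\<close> order_trans[of "\<Sum>i=1..k. n i" "4 * L * \<Delta>" "\<epsilon> * real k"]
    by (simp add: field_simps)
  show ?thesis
  proof (cases "4 * L * \<Delta> / \<epsilon> \<le> 1")
    \<comment> \<open>One iteration suffices here, but \<open>\<Delta>\<close> may be too small,
      even 0, to pay for it: this is the first argument of the maximum.\<close>
    case True
    then show ?thesis using avg[of 1] unfolding n_def by (intro exI[of _ 1]) auto
  next
    case False
    define r where "r = 4 * L * \<Delta> / \<epsilon>"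
    define k where "k = nat \<lceil>r\<rceil>"
    \<comment> \<open>As \<open>r\<close> exceeds 1, rounding up at most doubles it.\<close>
    have k: "r \<le> real k" "real k \<le> 2 * r" "1 \<le> k" using False unfolding k_def r_def[symmetric] by linarith+
    let ?K = "K * (1 + ln \<kappa>) * \<kappa>"
    have K1: "1 \<le> ?K"
    proof -
      have "1 \<le> K" using C_ge_1 by (simp add: inner_O_const_def)
      then show ?thesis using \<kappa>_ge_1 ln_\<kappa>_nonneg
        using mult_mono[of 1 K 1 "1 + ln \<kappa>"] mult_mono[of 1 "K * (1 + ln \<kappa>)" 1 \<kappa>] by simp
    qed
    have "real (complexity 1 1 1 1 T N k) = real k * (real T + real N + 2)"
      by (simp add: complexity_def algebra_simps)
    \<comment> \<open>\<open>T\<close>, \<open>N\<close> and each of the two remaining unit costs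
      are at most \<open>?K\<close>, hence the 4.\<close>
    also have "\<dots> \<le> (2 * r) * (4 * ?K)"
      using k(2) inner_iterations_bound K1 by (intro mult_mono) auto
    also have "\<dots> = 32 * (K * (1 + ln \<kappa>) * (\<kappa> / \<epsilon>) * \<Delta>) * L" by (simp add: r_def mult_ac)
    also have "\<dots> \<le> 32 * (K * (1 + ln \<kappa>) * (\<kappa> / \<epsilon>) * \<Delta>) * (\<kappa> ^ 3 * L\<^sub>1)"
      using L_bounds C_ge_1 ln_\<kappa>_nonneg \<kappa>_ge_1 \<Delta>0 \<open>0 < \<epsilon>\<close>
      by (intro mult_left_mono) (auto simp: inner_O_const_def)
    also have "\<dots> = 32 * (L\<^sub>1 * K * (1 + ln \<kappa>) * (\<kappa> ^ 4 / \<epsilon>) * \<Delta>)"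
      by (simp add: power3_eq_cube power4_eq_xxxx mult_ac)
    also have "\<dots> \<le> 100 * (L\<^sub>1 * K * (1 + ln \<kappa>) * (\<kappa> ^ 4 / \<epsilon>) * \<Delta>)"
      using L1_pos C_ge_1 ln_\<kappa>_nonneg \<kappa>_ge_1 \<Delta>0 \<open>0 < \<epsilon>\<close>
      by (intro mult_right_mono) (auto simp: inner_O_const_def)
    also have "\<dots> = complexity_O_const Lf B Lg Lg' Mg * (1 + ln \<kappa>) * (\<kappa> ^ 4 / \<epsilon>) * \<Delta>"
      by (simp add: complexity_O_const_def)
    finally show ?thesis using avg[OF k(3)] k unfolding n_def r_def by (intro exI[of _ k]) auto
  qed
qed

end

theorem corollary3:
  fixes f g :: "(real^'dx) \<times> (real^'dy) \<Rightarrow> real"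
    and x0 :: "real^'dx" and y' z' :: "real^'dy"
    and Lf B Lg Lg' Mg \<mu>g \<mu> L \<kappa> Lstar Ey Ez :: real
    and \<alpha> \<beta> \<gamma> :: "nat \<Rightarrow> real" and T N :: nat
  assumes constants: "0 \<le> Lf" "0 \<le> B" "0 \<le> Mg" "0 < \<mu>g" "0 < Lg'" "0 < Lf + Mg * B"
    and f_differentiable: "\<And>p. f differentiable (at p)"
    and g_twice_differentiable: "twice_differentiable g"
    and A1: "\<And>x. smooth_fun Lg (\<lambda>y. g (x, y))"
            "\<And>x. strongly_convex \<mu>g (\<lambda>y. g (x, y))"
    and A2: "Lf-lipschitz_on UNIV (grad f)"
            "\<And>p. norm (grad_y f p) \<le> B"
    and A3: "matrix_lipschitz Mg (hess_xy g)"
            "matrix_lipschitz Mg (hess_yy g)"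
            "\<And>x x' y. norm (grad_y g (x, y) - grad_y g (x', y)) \<le> Lg' * norm (x - x')"
    and Lstar: "bdd_below (range (outer_obj f g))" "Lstar = (INF x. outer_obj f g x)"
    and kappa: "\<kappa> = Lg / \<mu>g"
    and L: "L = L_const Lf B Lg' Mg \<mu>g"
    and nonconvex: "\<mu> < 0" "\<bar>\<mu>\<bar> \<le> L"
          "\<And>x x'. outer_obj f g x - outer_obj f g x'
                  \<le> grad (outer_obj f g) x \<bullet> (x - x') - \<mu> / 2 * (norm (x - x'))\<^sup>2"
    and steps: "\<And>k. \<alpha> k = 1 / Lg" "\<And>k. \<beta> k = 1 / (2 * Lg)" "\<And>k. \<gamma> k = 1 / L"
    and iters: "T = T_iter Lf B Lg Lg' Mg \<mu>g" "N = N_iter Lf B Lg Lg' Mg \<mu>g"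
    and init_errs: "Ey = init_err_y g x0 y'" "Ez = init_err_z f g (\<alpha> 0) T x0 y' z'"
  shows "real T \<le> inner_O_const Lf B Lg Lg' Mg * (1 + ln \<kappa>) * \<kappa>
       \<and> real N \<le> inner_O_const Lf B Lg Lg' Mg * (1 + ln \<kappa>) * \<kappa>
       \<and> (\<forall>\<epsilon>>0. \<exists>k\<ge>1.
            (1 / real k) *
              (\<Sum>i=1..k. (norm (grad (outer_obj f g) (amigo_x f g \<alpha> \<beta> \<gamma> T N x0 y' z' i)))\<^sup>2) \<le> \<epsilon>
          \<and> real (complexity 1 1 1 1 T N k)
              \<le> max (real (complexity 1 1 1 1 T N 1))
                    (complexity_O_const Lf B Lg Lg' Mg * (1 + ln \<kappa>) * (\<kappa> ^ 4 / \<epsilon>)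
                       * ((outer_obj f g x0 - Lstar) + Ey + Ez)))"
proof -
  interpret bilevel f g Lf B Lg Lg' Mg \<mu>g
    using constants f_differentiable g_twice_differentiable A1 A2 A3 by unfold_locales auto
  have lower: "Lstar \<le> outer_obj f g x" for x
    unfolding Lstar(2) by (rule cINF_lower[OF Lstar(1)]) simp
  have \<kappa>: "\<kappa> = bilevel.\<kappa> Lg \<mu>g" by (simp add: kappa \<kappa>_def)
  show ?thesis
    unfolding init_errs iters \<kappa>
    using inner_iterations_bound
      amigo_complexity[where \<alpha> = \<alpha> and \<beta> = \<beta> and \<gamma> = \<gamma> and ?x0.0 = x0 and y' = y' and z' = z',
        OF steps(1,2) steps(3)[unfolded L] lower]
    by blast
qed

end
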